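(* Let the underlying measure space be $[0,\infty)$ with Lebesgue measure. Let $w$ be a weight function, $W(t)=\int_0^tw(s)\,ds$, and let $0<p<\infty$. If $\Lambda_{w,p}$ is equivalent to an Orlicz space, then there are strictly monotone weight functions $w_0$ and $w_1$ satisfying condition $(L)$ and a number $c<\infty$ such that $$c^{-1}\,\frac{W(t)}{t}\le w_0(t)\,w_1(t)\le c\,\frac{W(t)}{t}\qquad\text{for all }t>0.$$
   Context: A $\varphi$-function is a function $F:[0,\infty)\to[0,\infty)$ that is continuous and strictly increasing with $F(0)=0$ and $\lim_{t\to\infty}F(t)=\infty$. For a measurable (complex-valued) function $f$, $f^*(x)=\sup\{t:\mu(|f|\ge t)\ge x\}$ is the non-increasing rearrangement. For a $\varphi$-function $F$, the Luxemburg functional is $\|f\|_F=\inf\{c:\int F(|f|/c)\,d\mu\le1\}$, and the Orlicz space $L_F$ is the space of measurable $f$ with $\|f\|_F<\infty$, modulo functions zero a.e.; "an Orlicz space" means $L_F$ for some $\varphi$-function $F$. A weight function is a function $w:(0,\infty)\to(0,\infty)$ such that $W(t)=\int_0^tw(s)\,ds$ is a $\varphi$-function. The Lorentz functional is $\|f\|_{w,p}=\left(\int_0^\infty w(x)f^*(x)^p\,dx\right)^{1/p}$, and $\Lambda_{w,p}$ is the space of measurable $f$ with $\|f\|_{w,p}<\infty$. Two function spaces $X,Y$ on the same measure space are equivalent if for some $c<\infty$ we have $f\in X\Leftrightarrow f\in Y$ with $c^{-1}\|f\|_X\le\|f\|_Y\le c\|f\|_X$ for all measurable $f$. A weight function $w$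 is strictly monotone if either $w$ is strictly increasing with $w(t)\to0$ as $t\to0$ and $w(t)\to\infty$ as $t\to\infty$, or $w$ is strictly decreasing with $w(t)\to\infty$ as $t\to0$ and $w(t)\to0$ as $t\to\infty$. A strictly monotone weight function $w$ satisfies condition $(L)$ if there is a number $0<c<\infty$ such that $\int_0^\infty\frac{dt}{w^{-1}(c\,w(t))}<\infty$, where $w^{-1}$ is the inverse function of $w$ (so in this condition $w$ is understood to be a bijection of $(0,\infty)$ onto itself). *)

theory Defs
  imports "HOL-Analysis.Analysis"
begin

definition phi_function :: "(real \<Rightarrow> real) \<Rightarrow> bool" where
  "phi_function F \<longleftrightarrow>
     F ` {0..} \<subseteq> {0..} \<and> continuous_on {0..} F \<and> strict_mono_on {0..} F \<and>
     F 0 = 0 \<and> filterlim F at_top at_top"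

text \<open>Real powers of extended non-negative reals, meant for exponents \<open>p > 0\<close>;
  in particular \<open>\<infinity>\<^sup>p = \<infinity>\<close>.\<close>

definition ennreal_pow :: "ennreal \<Rightarrow> real \<Rightarrow> ennreal" where
  "ennreal_pow x p = (if x = \<infinity> then \<infinity> else ennreal (enn2real x powr p))"

text \<open>The value is \<open>\<infinity>\<close> if the set of admissible \<open>t\<close> is unbounded.\<close>

definition rearrangement :: "'a measure \<Rightarrow> ('a \<Rightarrow> complex) \<Rightarrow> real \<Rightarrow> ennreal" where
  "rearrangement M f x =
     Sup {ennreal t | t. 0 \<le> t \<and> ennreal x \<le> emeasure M {y \<in> space M. t \<le> cmod (f y)}}"

text \<open>The functionals below are defined on functions; their values depend only on the
  almost-everywhere class, and are \<open>\<infinity>\<close> outside the corresponding space.\<close>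

definition luxemburg :: "'a measure \<Rightarrow> (real \<Rightarrow> real) \<Rightarrow> ('a \<Rightarrow> complex) \<Rightarrow> ennreal" where
  "luxemburg M F f =
     Inf {ennreal c | c. 0 < c \<and> (\<integral>\<^sup>+ y. ennreal (F (cmod (f y) / c)) \<partial>M) \<le> 1}"

definition orlicz_space :: "'a measure \<Rightarrow> (real \<Rightarrow> real) \<Rightarrow> ('a \<Rightarrow> complex) set" where
  "orlicz_space M F = {f \<in> borel_measurable M. luxemburg M F f < \<infinity>}"

definition weight_integral :: "(real \<Rightarrow> real) \<Rightarrow> real \<Rightarrow> real" where
  "weight_integral w t = set_lebesgue_integral lebesgue {0<..t} w"

text \<open>Only the values of \<open>w\<close> on \<open>(0, \<infinity>)\<close> matter here and below. Local integrability
  expresses that \<open>w\<close> is measurable and that its primitive is finite.\<close>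

definition weight_function :: "(real \<Rightarrow> real) \<Rightarrow> bool" where
  "weight_function w \<longleftrightarrow>
     w ` {0<..} \<subseteq> {0<..} \<and> (\<forall>t>0. set_integrable lebesgue {0<..t} w) \<and>
     phi_function (weight_integral w)"

definition lorentz ::
    "'a measure \<Rightarrow> (real \<Rightarrow> real) \<Rightarrow> real \<Rightarrow> ('a \<Rightarrow> complex) \<Rightarrow> ennreal" where
  "lorentz M w p f =
     ennreal_pow
       (\<integral>\<^sup>+ x. ennreal (w x) * ennreal_pow (rearrangement M f x) p \<partial>lebesgue_on {0<..})
       (1 / p)"

definition lorentz_space ::
    "'a measure \<Rightarrow> (real \<Rightarrow> real) \<Rightarrow> real \<Rightarrow> ('a \<Rightarrow> complex) set" where
  "lorentz_space M w p = {f \<in> borel_measurable M. lorentz M w p f < \<infinity>}"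

definition equivalent_spaces ::
    "'a measure \<Rightarrow> ('a \<Rightarrow> complex) set \<Rightarrow> (('a \<Rightarrow> complex) \<Rightarrow> ennreal) \<Rightarrow>
     ('a \<Rightarrow> complex) set \<Rightarrow> (('a \<Rightarrow> complex) \<Rightarrow> ennreal) \<Rightarrow> bool" where
  "equivalent_spaces M X normX Y normY \<longleftrightarrow>
     (\<exists>c::real. 0 < c \<and>
       (\<forall>f\<in>borel_measurable M.
          (f \<in> X \<longleftrightarrow> f \<in> Y) \<and>
          ennreal (1 / c) * normX f \<le> normY f \<and> normY f \<le> ennreal c * normX f))"

definition strictly_monotone_weight :: "(real \<Rightarrow> real) \<Rightarrow> bool" where
  "strictly_monotone_weight w \<longleftrightarrow>
     weight_function w \<and>
     (strict_mono_on {0<..} w \<and> (w \<longlongrightarrow> 0) (at_right 0) \<and> filterlim w at_top at_top \<or>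
      strict_antimono_on {0<..} w \<and> filterlim w at_top (at_right 0) \<and> (w \<longlongrightarrow> 0) at_top)"

text \<open>Bijectivity is required in order that the inverse function exists on all of
  \<open>(0, \<infinity>)\<close>; a strictly monotone weight function may have jumps.\<close>

definition condition_L :: "(real \<Rightarrow> real) \<Rightarrow> bool" where
  "condition_L w \<longleftrightarrow>
     bij_betw w {0<..} {0<..} \<and>
     (\<exists>c>0. (\<integral>\<^sup>+ t. ennreal (1 / inv_into {0<..} w (c * w t)) \<partial>lebesgue_on {0<..}) < \<infinity>)"

end

theory Submission
  imports Defs "HOL-Real_Asymp.Real_Asymp"
begin

text \<open>Put \<open>v(t) = W(t) / t\<close>. Testing the equivalence on \<open>f = max\<^sub>k a\<^sub>k 1\<^bsub>[0, p\<^sub>k]\<^esub>\<close> with \<open>a\<^sub>k\<close> a multiple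
  of \<open>W(q\<^sub>k)\<^bsup>-1/p\<^esup>\<close> shows, for separated points \<open>p\<^sub>k\<close>, that \<open>\<Sum>\<^sub>k p\<^sub>k / q\<^sub>k \<le> B\<close> as soon as
  \<open>\<Sum>\<^sub>k W(p\<^sub>k) / W(q\<^sub>k) \<le> 1 / B\<close>, and the same with \<open>W\<close> and the identity exchanged. Hence
  \<open>\<Sum>\<^sub>k p\<^sub>k / q\<^sub>k \<le> B\<close> for all disjoint intervals \<open>[p\<^sub>k, q\<^sub>k]\<close> on each of which \<open>v\<close> grows by a large
  factor, and also if it decreases by a large factor on each of them.

  A hysteresis operator on the grid \<open>t = e\<^sup>j\<close> decomposes \<open>ln v\<close>, up to a bounded error, into an upward
  and a downward variation, each of which changes by more than a fixed amount only across an interval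
  of this kind. The exponentials of these variations, made continuous by a Lipschitz minorant and
  strictly monotone by adding \<open>arsinh\<close>, are \<open>w\<^sub>0\<close> and \<open>1 / w\<^sub>1\<close>, and condition \<open>(L)\<close> is the bound
  \<open>\<Sum>\<^sub>k p\<^sub>k / q\<^sub>k \<le> B\<close> for the intervals between consecutive levels.\<close>

section \<open>Test inequalities\<close>

lemma phi_function_zero: "phi_function F \<Longrightarrow> F 0 = 0"
  and phi_function_strict_mono: "phi_function F \<Longrightarrow> 0 \<le> x \<Longrightarrow> x < y \<Longrightarrow> F x < F y"
  by (auto simp: phi_function_def strict_mono_on_def)

lemma phi_function_pos: "phi_function F \<Longrightarrow> 0 < x \<Longrightarrow> 0 < F x"
  using phi_function_strict_mono[of F 0 x] phi_function_zero[of F] by simp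

lemma phi_function_mono: "phi_function F \<Longrightarrow> 0 \<le> x \<Longrightarrow> x \<le> y \<Longrightarrow> F x \<le> F y"
  using phi_function_strict_mono[of F x y] by (cases "x = y") auto

lemma phi_function_nonneg: "phi_function F \<Longrightarrow> 0 \<le> x \<Longrightarrow> 0 \<le> F x"
  using phi_function_mono[of F 0 x] phi_function_zero[of F] by simp

lemma phi_function_le_cancel: "phi_function F \<Longrightarrow> 0 < x \<Longrightarrow> 0 < y \<Longrightarrow> F x \<le> F y \<Longrightarrow> x \<le> y"
  using phi_function_strict_mono[of F y x] by fastforce

lemma phi_function_surj:
  assumes F: "phi_function F" and "0 < y"
  obtains x where "0 < x" "F x = y"
proof -
  have "eventually (\<lambda>x. y \<le> F x) at_top"
    using F by (simp add: phi_function_def filterlim_at_top)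
  with eventually_ge_at_top[of 0] have "eventually (\<lambda>x. 0 \<le> x \<and> y \<le> F x) at_top"
    by (rule eventually_conj)
  then obtain b where b: "0 \<le> b" "y \<le> F b"
    using eventually_happens' trivial_limit_at_top_linorder by blast
  have "continuous_on {0..b} F"
    using F by (auto simp: phi_function_def intro: continuous_on_subset)
  then obtain x where "0 \<le> x" "F x = y"
    using IVT'[of F 0 y b] b assms phi_function_zero[OF F] by auto
  with assms phi_function_zero[OF F] have "0 < x"
    by (cases "x = 0") auto
  with \<open>F x = y\<close> show ?thesis by (rule that[rotated])
qed

lemma phi_function_ident: "phi_function (\<lambda>x. x)"
  by (auto simp: phi_function_def strict_mono_on_def filterlim_ident)

text \<open>Stated for a pair so that it serves both for the identity against \<open>W\<close> and
  for \<open>W\<close> against the identity. Only the \<open>p i\<close>, the jumps of the test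
  function, have to be separated; the \<open>q i\<close> merely determine its heights.\<close>

definition test_inequality :: "(real \<Rightarrow> real) \<Rightarrow> (real \<Rightarrow> real) \<Rightarrow> real \<Rightarrow> bool" where
  "test_inequality X Y B \<longleftrightarrow>
     (\<forall>(I::nat set) p q. finite I \<longrightarrow> (\<forall>i\<in>I. 0 < p i \<and> 0 < q i) \<longrightarrow>
        (\<forall>i\<in>I. \<forall>j\<in>I. i \<noteq> j \<longrightarrow> 2 * X (p i) \<le> X (p j) \<or> 2 * X (p j) \<le> X (p i)) \<longrightarrow>
        B * (\<Sum>i\<in>I. Y (p i) / Y (q i)) \<le> 1 \<longrightarrow> (\<Sum>i\<in>I. X (p i) / X (q i)) \<le> B)"

lemma test_inequalityD:
  fixes I :: "nat set"
  assumes "test_inequality X Y B" "finite I" "\<And>i. i \<in> I \<Longrightarrow> 0 < p i" "\<And>i. i \<in> I \<Longrightarrow> 0 < q i"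
    "\<And>i j. i \<in> I \<Longrightarrow> j \<in> I \<Longrightarrow> i < j \<Longrightarrow> 2 * X (p i) \<le> X (p j) \<or> 2 * X (p j) \<le> X (p i)"
    "B * (\<Sum>i\<in>I. Y (p i) / Y (q i)) \<le> 1"
  shows "(\<Sum>i\<in>I. X (p i) / X (q i)) \<le> B"
proof -
  have "2 * X (p i) \<le> X (p j) \<or> 2 * X (p j) \<le> X (p i)" if "i \<in> I" "j \<in> I" "i \<noteq> j" for i j
    using assms(5)[of i j] assms(5)[of j i] that by (cases "i < j") auto
  then show ?thesis
    using assms(1)[unfolded test_inequality_def, rule_format, of I p q] assms(2-4,6) by simp
qed

text \<open>Points at which doubling fails badly would, if \<open>X\<close> were unbounded or not bounded away from
  \<open>0\<close> on them, contain a long separated sequence violating the test inequality. So they form a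
  compact subset of \<open>(0, \<infinity>)\<close>, where the quotients are bounded anyway.\<close>

lemma test_inequality_doubling:
  assumes X: "phi_function X" and Y: "phi_function Y" and T: "test_inequality X Y B" and "1 \<le> B"
  obtains D where "\<And>x z. 0 < x \<Longrightarrow> 0 < z \<Longrightarrow> X z \<le> 2 * X x \<Longrightarrow> Y z \<le> D * Y x"
proof -
  \<comment> \<open>\<open>N\<close> terms of size at least 1/2 exceed \<open>B\<close>, whereas
    \<open>N\<close> terms of size at most \<open>1 / E\<close> add up to at most
    \<open>1 / B\<close>. So \<open>N\<close> separated points at which doubling fails with the
    constant \<open>E\<close> contradict the test inequality.\<close>
  obtain N :: nat where N: "real N > 2 * B"
    using reals_Archimedean2 by blast
  define E where "E = B * real N"
  have E: "0 < E" using N \<open>1 \<le> B\<close> by (simp add: E_def)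
  define S where "S = {x. 0 < x \<and> (\<exists>z>0. X z \<le> 2 * X x \<and> E * Y x < Y z)}"
  have no_seq: False
    if p: "\<And>i::nat. p i \<in> S"
      and sep: "\<And>i j. i < j \<Longrightarrow> 2 * X (p i) \<le> X (p j) \<or> 2 * X (p j) \<le> X (p i)" for p
  proof -
    from p have "\<forall>i. \<exists>z. 0 < z \<and> X z \<le> 2 * X (p i) \<and> E * Y (p i) < Y z"
      by (auto simp: S_def)
    then obtain q where q: "\<And>i. 0 < q i" "\<And>i. X (q i) \<le> 2 * X (p i)" "\<And>i. E * Y (p i) < Y (q i)"
      by metis
    have p0: "0 < p i" for i using p[of i] by (simp add: S_def)
    have "Y (p i) / Y (q i) \<le> 1 / E" for i
      using q(3)[of i] E phi_function_pos[OF Y q(1), of i] by (simp add: field_simps)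
    then have "(\<Sum>i<N. Y (p i) / Y (q i)) \<le> (\<Sum>i<N. 1 / E)"
      by (intro sum_mono) auto
    also have "\<dots> = 1 / B" using N \<open>1 \<le> B\<close> by (simp add: E_def)
    finally have "B * (\<Sum>i<N. Y (p i) / Y (q i)) \<le> 1"
      using \<open>1 \<le> B\<close> by (simp add: field_simps)
    then have le: "(\<Sum>i<N. X (p i) / X (q i)) \<le> B"
      using T p0 q(1) sep by (intro test_inequalityD[where Y = Y]) auto
    have "1 / 2 \<le> X (p i) / X (q i)" for i
      using q(2)[of i] phi_function_pos[OF X q(1), of i] by (simp add: field_simps)
    then have "(\<Sum>i<N. 1 / 2) \<le> (\<Sum>i<N. X (p i) / X (q i))"
      by (intro sum_mono) auto
    with le N show False by simp
  qed
  have "\<exists>b>0. \<forall>x\<in>S. X x \<le> b"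
  proof (rule ccontr)
    assume "\<not> ?thesis"
    then have *: "\<exists>x\<in>S. b < X x" if "0 < b" for b using that by force
    have "\<exists>p. \<forall>i. p i \<in> S \<and> 2 * X (p i) \<le> X (p (Suc i))"
    proof (rule dependent_nat_choice)
      show "\<exists>x. x \<in> S" using *[of 1] by auto
    next
      fix x :: real and n :: nat assume "x \<in> S"
      then have "0 < X x" using phi_function_pos[OF X] by (simp add: S_def)
      then show "\<exists>y. y \<in> S \<and> 2 * X x \<le> X y" using *[of "2 * X x"] by force
    qed
    then obtain p where p: "\<And>i. p i \<in> S" "\<And>i. 2 * X (p i) \<le> X (p (Suc i))" by blast
    have pos: "0 < X (p i)" for i using phi_function_pos[OF X] p(1)[of i] by (simp add: S_def)
    have "X (p i) \<le> X (p (Suc i))" for i using p(2)[of i] pos[of i] by linarith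
    then have mono: "i \<le> j \<Longrightarrow> X (p i) \<le> X (p j)" for i j
      using lift_Suc_mono_le[of "\<lambda>i. X (p i)"] by blast
    have "2 * X (p i) \<le> X (p j)" if "i < j" for i j
      using p(2)[of i] mono[of "Suc i" j] that by simp
    with p(1) show False using no_seq by blast
  qed
  then obtain b where b: "0 < b" "\<And>x. x \<in> S \<Longrightarrow> X x \<le> b" by blast
  have "\<exists>a>0. \<forall>x\<in>S. a \<le> X x"
  proof (rule ccontr)
    assume "\<not> ?thesis"
    then have *: "\<exists>x\<in>S. X x < a" if "0 < a" for a using that by force
    have "\<exists>p. \<forall>i. p i \<in> S \<and> 2 * X (p (Suc i)) \<le> X (p i)"
    proof (rule dependent_nat_choice)
      show "\<exists>x. x \<in> S" using *[of 1] by auto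
    next
      fix x :: real and n :: nat assume "x \<in> S"
      then have "0 < X x" using phi_function_pos[OF X] by (simp add: S_def)
      then show "\<exists>y. y \<in> S \<and> 2 * X y \<le> X x" using *[of "X x / 2"] by force
    qed
    then obtain p where p: "\<And>i. p i \<in> S" "\<And>i. 2 * X (p (Suc i)) \<le> X (p i)" by blast
    have pos: "0 < X (p i)" for i using phi_function_pos[OF X] p(1)[of i] by (simp add: S_def)
    have "X (p (Suc i)) \<le> X (p i)" for i using p(2)[of i] pos[of "Suc i"] by linarith
    then have mono: "i \<le> j \<Longrightarrow> X (p j) \<le> X (p i)" for i j
      using lift_Suc_antimono_le[of "\<lambda>i. X (p i)"] by blast
    have "2 * X (p j) \<le> X (p i)" if "i < j" for i j
      using p(2)[of i] mono[of "Suc i" j] that by simp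
    with p(1) show False using no_seq by blast
  qed
  then obtain a where a: "0 < a" "\<And>x. x \<in> S \<Longrightarrow> a \<le> X x" by blast
  \<comment> \<open>A point \<open>x\<close> of \<open>S\<close> lies above \<open>u\<close>, and
    since \<open>X z \<le> 2 * X x \<le> 2 * b\<close>, the corresponding \<open>z\<close> lies
    below \<open>m\<close>; hence \<open>Y m / Y u\<close> serves as constant on
    \<open>S\<close>.\<close>
  obtain u where u: "0 < u" "X u = a" using phi_function_surj[OF X a(1)] .
  obtain m where m: "0 < m" "X m = 2 * b" using phi_function_surj[OF X, of "2 * b"] b(1) by auto
  show ?thesis
  proof
    fix x z :: real assume x: "0 < x" and z: "0 < z" and xz: "X z \<le> 2 * X x"
    have Yx: "0 < Y x" and Yu: "0 < Y u" using phi_function_pos[OF Y] x u by auto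
    show "Y z \<le> max E (Y m / Y u) * Y x"
    proof (cases "x \<in> S")
      case True
      then have "X u \<le> X x" "X z \<le> X m"
        using a(2)[of x] b(2)[of x] u m xz by auto
      then have "u \<le> x" "z \<le> m"
        using phi_function_le_cancel[OF X] x z u m by auto
      then have "Y u \<le> Y x" "Y z \<le> Y m"
        using phi_function_mono[OF Y] u z by auto
      then have le: "Y z \<le> Y m / Y u * Y u" "Y m / Y u * Y u \<le> Y m / Y u * Y x"
        using Yu phi_function_pos[OF Y m(1)] by (simp, intro mult_left_mono) auto
      note le(2)
      also have "Y m / Y u * Y x \<le> max E (Y m / Y u) * Y x"
        using Yx by (intro mult_right_mono) auto
      finally show ?thesis using le(1) by linarith
    next
      case False
      with x z xz have "Y z \<le> E * Y x" by (auto simp: S_def)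
      also have "\<dots> \<le> max E (Y m / Y u) * Y x"
        using Yx by (intro mult_right_mono) auto
      finally show ?thesis .
    qed
  qed
qed

section \<open>Sums over disjoint intervals on which a quotient grows\<close>

definition ordered_intervals :: "nat set \<Rightarrow> (nat \<Rightarrow> 'a::linorder) \<Rightarrow> (nat \<Rightarrow> 'a) \<Rightarrow> bool" where
  "ordered_intervals I p q \<longleftrightarrow>
     finite I \<and> (\<forall>i\<in>I. p i < q i) \<and> (\<forall>i\<in>I. \<forall>j\<in>I. i < j \<longrightarrow> q i \<le> p j)"

lemma ordered_intervals_subset:
  "ordered_intervals I p q \<Longrightarrow> J \<subseteq> I \<Longrightarrow> ordered_intervals J p q"
  by (auto simp: ordered_intervals_def dest: finite_subset)

text \<open>The third hypothesis on the intervals says that \<open>Y / X\<close> grows at least by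
  the factor \<open>K\<close> on each of them. Since \<open>X\<close> does not decrease,
  \<open>Y\<close> then grows by more than the doubling constant, so \<open>X\<close> itself at
  least doubles and the points \<open>p i\<close> are separated.\<close>

lemma test_inequality_increments:
  assumes X: "phi_function X" and Y: "phi_function Y" and T: "test_inequality X Y B" and B: "1 \<le> B"
  obtains K where "1 < K" and
    "\<And>I p q. ordered_intervals I p q \<Longrightarrow> (\<And>i. i \<in> I \<Longrightarrow> 0 < p i) \<Longrightarrow>
       (\<And>i. i \<in> I \<Longrightarrow> K * (Y (p i) / Y (q i)) \<le> X (p i) / X (q i)) \<Longrightarrow>
       (\<Sum>i\<in>I. X (p i) / X (q i)) \<le> B"
proof -
  obtain D where D: "\<And>x z. 0 < x \<Longrightarrow> 0 < z \<Longrightarrow> X z \<le> 2 * X x \<Longrightarrow> Y z \<le> D * Y x"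
    using test_inequality_doubling[OF assms] by blast
  \<comment> \<open>\<open>D + 1\<close> gives the separation; \<open>B * (B + 1)\<close> turns a
    preliminary bound \<open>B + 1\<close> for the \<open>X\<close> quotients into the bound
    \<open>1 / B\<close> for the \<open>Y\<close> quotients.\<close>
  define K where "K = max (D + 1) (B * (B + 1))"
  have "1 * 2 \<le> B * (B + 1)" using B by (intro mult_mono) auto
  then have K1: "1 < K" by (simp add: K_def)
  have KB: "B * (B + 1) \<le> K" and KD: "D < K" by (auto simp: K_def)
  show ?thesis
  proof (rule that[OF K1])
    fix I :: "nat set" and p q :: "nat \<Rightarrow> real"
    assume ord: "ordered_intervals I p q" and p0: "\<And>i. i \<in> I \<Longrightarrow> 0 < p i"
      and up: "\<And>i. i \<in> I \<Longrightarrow> K * (Y (p i) / Y (q i)) \<le> X (p i) / X (q i)"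
    have pq: "p i < q i" if "i \<in> I" for i using ord that by (simp add: ordered_intervals_def)
    have q0: "0 < q i" if "i \<in> I" for i using pq[OF that] p0[OF that] by simp
    have ratio: "X (p i) / X (q i) \<le> 1" if "i \<in> I" for i
      using phi_function_mono[OF X, of "p i" "q i"] phi_function_pos[OF X q0[OF that]]
        pq[OF that] p0[OF that] by simp
    have far: "2 * X (p i) \<le> X (q i)" if i: "i \<in> I" for i
    proof (rule ccontr)
      assume "\<not> ?thesis"
      then have "Y (q i) \<le> D * Y (p i)" using D[OF p0[OF i] q0[OF i]] by simp
      also have "\<dots> < K * Y (p i)" using KD phi_function_pos[OF Y p0[OF i]] by simp
      also have "\<dots> \<le> Y (q i)"
        using order_trans[OF up[OF i] ratio[OF i]] phi_function_pos[OF Y q0[OF i]]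
        by (simp add: field_simps)
      finally show False by simp
    qed
    have sep: "2 * X (p i) \<le> X (p j)" if "i \<in> I" "j \<in> I" "i < j" for i j
    proof -
      have "q i \<le> p j" using ord that by (simp add: ordered_intervals_def)
      then have "X (q i) \<le> X (p j)" using phi_function_mono[OF X] q0[OF that(1)] by simp
      with far[OF that(1)] show ?thesis by simp
    qed
    \<comment> \<open>Bootstrapping: one more interval raises the sum from \<open>B\<close> to at
      most \<open>B + 1\<close>; by the choice of \<open>K\<close> this still makes the sum of the
      \<open>Y\<close> quotients at most \<open>1 / B\<close>, and the test inequality restores the
      bound \<open>B\<close>.\<close>
    have "J \<subseteq> I \<Longrightarrow> (\<Sum>i\<in>J. X (p i) / X (q i)) \<le> B" if "finite J" for J
      using that
    proof (induction J rule: finite_induct)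
      case empty
      then show ?case using B by simp
    next
      case (insert k J)
      have kJ: "i \<in> I" if "i \<in> insert k J" for i using insert.prems that by blast
      have *: "(\<Sum>i\<in>insert k J. X (p i) / X (q i)) \<le> B + 1"
        using insert ratio[of k] by simp
      have "K * (\<Sum>i\<in>insert k J. Y (p i) / Y (q i)) \<le> (\<Sum>i\<in>insert k J. X (p i) / X (q i))"
        using up kJ by (auto simp: sum_distrib_left simp del: sum.insert intro!: sum_mono)
      with * have S: "K * (\<Sum>i\<in>insert k J. Y (p i) / Y (q i)) \<le> B + 1" by linarith
      have nonneg: "0 \<le> (\<Sum>i\<in>insert k J. Y (p i) / Y (q i))"
        using phi_function_pos[OF Y] p0 q0 kJ by (intro sum_nonneg) (auto simp: less_imp_le)
      have "(B + 1) * (B * (\<Sum>i\<in>insert k J. Y (p i) / Y (q i))) \<le> (B + 1) * 1"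
        using mult_right_mono[OF KB nonneg] S by (simp add: mult_ac)
      then have "B * (\<Sum>i\<in>insert k J. Y (p i) / Y (q i)) \<le> 1"
        using B by (simp only: mult_le_cancel_left_pos)
      then show ?case
        using insert.hyps(1) p0[OF kJ] q0[OF kJ] sep[OF kJ kJ]
        by (intro test_inequalityD[OF T]) (simp_all del: sum.insert)
    qed
    then show "(\<Sum>i\<in>I. X (p i) / X (q i)) \<le> B" using ord by (simp add: ordered_intervals_def)
  qed
qed

section \<open>Hysteresis\<close>

text \<open>The hysteresis operator: the output stays within distance \<open>c\<close> of the input and moves only when
  it is forced to.\<close>

primrec play :: "real \<Rightarrow> (nat \<Rightarrow> real) \<Rightarrow> nat \<Rightarrow> real" where
  "play c f 0 = f 0"
| "play c f (Suc n) = max (f (Suc n) - c) (min (play c f n) (f (Suc n) + c))"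

text \<open>The upward variation of the play. The downward variation is obtained by applying this to
  \<open>- f\<close>.\<close>

definition play_up :: "real \<Rightarrow> (nat \<Rightarrow> real) \<Rightarrow> nat \<Rightarrow> real" where
  "play_up c f n = (\<Sum>i<n. max 0 (play c f (Suc i) - play c f i))"

text \<open>For \<open>0 \<le> c\<close> the clippings from above and from below commute, so the
  play treats both directions alike.\<close>

lemma play_uminus: "0 \<le> c \<Longrightarrow> play c (\<lambda>n. - f n) n = - play c f n"
  by (induction n) (auto simp: max_def min_def)

lemma play_bounds: "0 \<le> c \<Longrightarrow> f n - c \<le> play c f n \<and> play c f n \<le> f n + c"
  by (induction n) auto

text \<open>An upward move ends at \<open>f (Suc n) - c\<close>, and it starts at or above
  \<open>f n - c\<close>.\<close>

lemma play_up_step: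
  assumes "0 \<le> c" "f (Suc n) - f n \<le> L" "0 \<le> L"
  shows "play_up c f (Suc n) - play_up c f n \<le> L"
  using play_bounds[OF assms(1), of f n] assms by (auto simp: play_up_def)

text \<open>The Jordan decomposition of the play, whose initial value is \<open>f 0\<close>.\<close>

lemma play_decomposition:
  assumes "0 \<le> c"
  shows "play c f n - f 0 = play_up c f n - play_up c (\<lambda>n. - f n) n"
proof -
  have "play c f n - play c f 0 = (\<Sum>i<n. play c f (Suc i) - play c f i)"
    by (simp only: sum_lessThan_telescope)
  also have "\<dots> = (\<Sum>i<n. max 0 (play c f (Suc i) - play c f i)
                 - max 0 (- play c f (Suc i) - - play c f i))"
    by (intro sum.cong) (auto simp: max_def)
  finally show ?thesis
    by (simp add: play_up_def play_uminus[OF assms] sum_subtractf del: play.simps(2))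
qed

lemma play_up_Suc: "play_up c f (Suc n) = play_up c f n + max 0 (play c f (Suc n) - play c f n)"
  by (simp add: play_up_def)

lemma play_up_mono: "i \<le> j \<Longrightarrow> play_up c f i \<le> play_up c f j"
  using lift_Suc_mono_le[of "play_up c f" i j] by (simp add: play_up_Suc del: play.simps)

text \<open>Without an increase of \<open>f\<close> by more than \<open>2 c\<close>, the play cannot move up any more once it has
  moved down.\<close>

lemma play_up_increase:
  assumes c: "0 \<le> c" and jk: "j \<le> k" and up: "4 * c < play_up c f k - play_up c f j"
  obtains i i' where "j \<le> i" "i \<le> i'" "i' \<le> k" "2 * c < f i' - f i"
proof -
  have False if no: "\<And>i i'. j \<le> i \<Longrightarrow> i \<le> i' \<Longrightarrow> i' \<le> k \<Longrightarrow> f i' - f i \<le> 2 * c"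
  proof -
    \<comment> \<open>Invariant: either the play has only risen since \<open>j\<close>, or it
      already lies above everything that could still push it up, so that the upward variation is
      frozen. A pure rise is at most \<open>4 * c\<close>: \<open>2 * c\<close> from
      \<open>f\<close>, and \<open>c\<close> at either end for the distance between play and
      input.\<close>
    have "play_up c f i - play_up c f j = play c f i - play c f j \<or>
        (play_up c f i - play_up c f j \<le> 4 * c \<and> (\<forall>l. i \<le> l \<longrightarrow> l \<le> k \<longrightarrow> f l - c \<le> play c f i))"
      if "j \<le> i" "i \<le> k" for i
      using that
    proof (induction i rule: dec_induct)
      case base
      then show ?case by simp
    next
      case (step n)
      from step.IH step.prems consider
        (a) "play_up c f n - play_up c f j = play c f n - play c f j"
        | (b) "play_up c f n - play_up c f j \<le> 4 * c" "\<forall>l. n \<le> l \<longrightarrow> l \<le> k \<longrightarrow> f l - c \<le> play c f n"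
        by force
      then show ?case
      proof cases
        case a
        show ?thesis
        proof (cases "play c f n \<le> play c f (Suc n)")
          case True
          with a show ?thesis by (simp add: play_up_Suc del: play.simps)
        next
          case False
          then have eq: "play c f (Suc n) = f (Suc n) + c"
            using c by auto
          have "play c f n - play c f j \<le> 4 * c"
            using play_bounds[OF c, of f n] play_bounds[OF c, of f j] no[of j n] step by force
          \<comment> \<open>After a downward move the play equals \<open>f (Suc n) + c\<close>, and
            \<open>f l\<close> exceeds \<open>f (Suc n)\<close> by at most
            \<open>2 * c\<close>.\<close>
          moreover have "f l - c \<le> play c f (Suc n)" if "Suc n \<le> l" "l \<le> k" for l
            using no[of "Suc n" l] that step eq by simp
          ultimately show ?thesis
            using a False by (simp add: play_up_Suc del: play.simps)
        qed
      next
        case b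
        then have "f (Suc n) - c \<le> play c f n" using step by auto
        then have eq: "play c f (Suc n) = min (play c f n) (f (Suc n) + c)"
          using c by auto
        have "f l - c \<le> play c f (Suc n)" if "Suc n \<le> l" "l \<le> k" for l
          using no[of "Suc n" l] that step b(2) unfolding eq by auto
        moreover have "play c f (Suc n) \<le> play c f n" unfolding eq by simp
        ultimately show ?thesis using b(1) by (simp add: play_up_Suc del: play.simps)
      qed
    qed
    from this[of k] jk
    have "play_up c f k - play_up c f j = play c f k - play c f j \<or> play_up c f k - play_up c f j \<le> 4 * c"
      by auto
    with up play_bounds[OF c, of f k] play_bounds[OF c, of f j] no[of j k] jk show False
      by auto
  qed
  then show ?thesis using that by force
qed

text \<open>Started at \<open>0\<close> and run in both directions; reversal of the index exchanges upward and downward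
  movements, hence the sign of \<open>f\<close> in the second case.\<close>

definition bi_up :: "real \<Rightarrow> (int \<Rightarrow> real) \<Rightarrow> int \<Rightarrow> real" where
  "bi_up c f j = (if 0 \<le> j then play_up c (\<lambda>n. f (int n)) (nat j)
                 else - play_up c (\<lambda>n. - f (- int n)) (nat (- j)))"

lemma play_up_0 [simp]: "play_up c f 0 = 0"
  by (simp add: play_up_def)

text \<open>The Jordan decomposition with the play replaced by its input, at the cost of
  \<open>c\<close>. At negative indices the exchange of the two variations and the minus sign in
  \<open>bi_up\<close> cancel.\<close>

lemma bi_up_decomposition:
  assumes "0 \<le> c"
  shows "\<bar>f j - f 0 - (bi_up c f j - bi_up c (\<lambda>i. - f i) j)\<bar> \<le> c"
proof (cases "0 \<le> j")
  case True
  then show ?thesis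
    using play_decomposition[OF assms, of "\<lambda>n. f (int n)" "nat j"]
      play_bounds[OF assms, of "\<lambda>n. f (int n)" "nat j"]
    by (simp add: bi_up_def abs_le_iff)
next
  case False
  then show ?thesis
    using play_decomposition[OF assms, of "\<lambda>n. f (- int n)" "nat (- j)"]
      play_bounds[OF assms, of "\<lambda>n. f (- int n)" "nat (- j)"]
    by (simp add: bi_up_def abs_le_iff)
qed

lemma bi_up_step:
  assumes "0 \<le> c" "0 \<le> L" "\<And>j. f (j + 1) - f j \<le> L"
  shows "bi_up c f (j + 1) - bi_up c f j \<le> L"
proof (cases "0 \<le> j")
  case True
  then have "nat (j + 1) = Suc (nat j)" by simp
  then show ?thesis
    using True play_up_step[OF assms(1), of "\<lambda>n. f (int n)" "nat j" L] assms(2) assms(3)[of j]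
    by (simp add: bi_up_def add.commute)
next
  case False
  then have eq: "nat (- j) = Suc (nat (- (j + 1)))" by simp
  have "bi_up c f (j + 1) = - play_up c (\<lambda>n. - f (- int n)) (nat (- (j + 1)))"
    using False by (cases "j = -1") (auto simp: bi_up_def)
  moreover have "bi_up c f j = - play_up c (\<lambda>n. - f (- int n)) (Suc (nat (- (j + 1))))"
    using False eq by (simp only: bi_up_def if_False)
  moreover have "play_up c (\<lambda>n. - f (- int n)) (Suc (nat (- (j + 1))))
      - play_up c (\<lambda>n. - f (- int n)) (nat (- (j + 1))) \<le> L"
    using False assms(2) assms(3)[of j]
    by (intro play_up_step[OF assms(1)]) (auto simp: algebra_simps)
  ultimately show ?thesis by linarith
qed

lemma bi_up_mono:
  assumes "i \<le> j"
  shows "bi_up c f i \<le> bi_up c f j"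
proof -
  have nonneg: "0 \<le> play_up c g n" for g n
    using play_up_mono[of 0 n c g] by simp
  consider "0 \<le> i" "0 \<le> j" | "i < 0" "0 \<le> j" | "i < 0" "j < 0" using assms by linarith
  then show ?thesis
  proof cases
    case 2
    then show ?thesis
      using nonneg[of "\<lambda>n. f (int n)" "nat j"] nonneg[of "\<lambda>n. - f (- int n)" "nat (- i)"]
      by (simp add: bi_up_def)
  qed (use assms in \<open>auto simp: bi_up_def intro!: play_up_mono\<close>)
qed

text \<open>The threshold is twice that of the one-sided version because the interval may contain 0;
  then one of its two halves carries more than \<open>4 * c\<close>.\<close>

lemma bi_up_increase:
  assumes c: "0 \<le> c" and up: "8 * c < bi_up c f k - bi_up c f j" and jk: "j \<le> k"
  obtains i i' where "j \<le> i" "i \<le> i'" "i' \<le> k" "2 * c < f i' - f i"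
proof -
  note witness = that
  have pos: thesis if jk: "0 \<le> j'" "j \<le> j'" "j' \<le> k'" "k' \<le> k"
    and up: "4 * c < bi_up c f k' - bi_up c f j'" for j' k'
  proof -
    have "4 * c < play_up c (\<lambda>n. f (int n)) (nat k') - play_up c (\<lambda>n. f (int n)) (nat j')"
      using up jk by (simp add: bi_up_def)
    moreover have "nat j' \<le> nat k'" using jk by simp
    ultimately obtain i i' where "nat j' \<le> i" "i \<le> i'" "i' \<le> nat k'" "2 * c < f (int i') - f (int i)"
      using play_up_increase[OF c] by blast
    with jk show thesis by (intro witness[of "int i" "int i'"]) auto
  qed
  have neg: thesis if jk: "k' \<le> 0" "j \<le> j'" "j' \<le> k'" "k' \<le> k"
    and up: "4 * c < bi_up c f k' - bi_up c f j'" for k' j'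
  proof -
    have "bi_up c f l = - play_up c (\<lambda>n. - f (- int n)) (nat (- l))" if "l \<le> 0" for l
      using that by (cases "l = 0") (auto simp: bi_up_def)
    then have "4 * c < play_up c (\<lambda>n. - f (- int n)) (nat (- j')) - play_up c (\<lambda>n. - f (- int n)) (nat (- k'))"
      using up jk by simp
    moreover have "nat (- k') \<le> nat (- j')" using jk by simp
    ultimately obtain i i' where "nat (- k') \<le> i" "i \<le> i'" "i' \<le> nat (- j')" "2 * c < - f (- int i') - - f (- int i)"
      using play_up_increase[OF c] by blast
    with jk show thesis by (intro witness[of "- int i'" "- int i"]) auto
  qed
  have le: "4 * c \<le> 8 * c" using c by simp
  consider "0 \<le> j" | "k \<le> 0" | "j < 0" "0 < k" by linarith
  then show ?thesis
  proof cases
    case 1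
    then show ?thesis using pos[of j k] jk up le by simp
  next
    case 2
    then show ?thesis using neg[of k j] jk up le by simp
  next
    case 3
    then consider "4 * c < bi_up c f k - bi_up c f 0" | "4 * c < bi_up c f 0 - bi_up c f j"
      using up by linarith
    then show ?thesis using pos[of 0 k] neg[of 0 j] 3 by cases auto
  qed
qed

section \<open>Lipschitz interpolation of monotone sequences\<close>

definition lipschitz_minorant :: "real \<Rightarrow> (int \<Rightarrow> real) \<Rightarrow> real \<Rightarrow> real" where
  "lipschitz_minorant L U x = (INF j. U j + L * max 0 (x - of_int j))"

context
  fixes L :: real and U :: "int \<Rightarrow> real"
  assumes L: "0 \<le> L" and mono: "\<And>i j. i \<le> j \<Longrightarrow> U i \<le> U j" and step: "\<And>j. U (j + 1) - U j \<le> L"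
begin

lemma step_le: "i \<le> j \<Longrightarrow> U j \<le> U i + L * (of_int j - of_int i)"
proof (induction j rule: int_ge_induct)
  case (step j)
  then show ?case using \<open>U (j + 1) - U j \<le> L\<close> by (simp add: algebra_simps)
qed simp

text \<open>No competitor in the infimum falls below the value at the floor of \<open>x\<close>: to
  the left \<open>U\<close> climbs by at most \<open>L\<close> per step, to the right it is already
  at least as large.\<close>

lemma minorant_term: "U \<lfloor>x\<rfloor> \<le> U j + L * max 0 (x - of_int j)"
proof (cases "j \<le> \<lfloor>x\<rfloor>")
  case True
  have "L * (of_int \<lfloor>x\<rfloor> - of_int j) \<le> L * max 0 (x - of_int j)"
    using L by (intro mult_left_mono) linarith+
  with step_le[OF True] show ?thesis by simp
next
  case False
  then have "U \<lfloor>x\<rfloor> \<le> U j" by (intro mono) auto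
  then show ?thesis using L by (simp add: add_increasing2)
qed

lemma minorant_bdd: "bdd_below (range (\<lambda>j. U j + L * max 0 (x - of_int j)))"
  using minorant_term[of x] by (intro bdd_belowI) auto

lemma lipschitz_minorant_ge: "U \<lfloor>x\<rfloor> \<le> lipschitz_minorant L U x"
  unfolding lipschitz_minorant_def by (intro cINF_greatest minorant_term) auto

lemma lipschitz_minorant_le: "lipschitz_minorant L U x \<le> U \<lfloor>x\<rfloor> + L"
proof -
  have "lipschitz_minorant L U x \<le> U \<lfloor>x\<rfloor> + L * max 0 (x - of_int \<lfloor>x\<rfloor>)"
    unfolding lipschitz_minorant_def by (intro cINF_lower minorant_bdd) auto
  also have "L * max 0 (x - of_int \<lfloor>x\<rfloor>) \<le> L * 1"
    using L by (intro mult_left_mono) linarith+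
  finally show ?thesis by simp
qed

text \<open>This is where the one-sided cost \<open>max 0 (x - of_int j)\<close> matters: every
  competitor is nondecreasing in \<open>x\<close>.\<close>

lemma lipschitz_minorant_mono:
  assumes "x \<le> y"
  shows "lipschitz_minorant L U x \<le> lipschitz_minorant L U y"
  unfolding lipschitz_minorant_def
proof (intro cINF_mono minorant_bdd)
  fix j :: int
  have "L * max 0 (x - of_int j) \<le> L * max 0 (y - of_int j)"
    using L assms by (intro mult_left_mono) auto
  then show "\<exists>i\<in>UNIV. U i + L * max 0 (x - of_int i) \<le> U j + L * max 0 (y - of_int j)"
    by (intro bexI[of _ j]) auto
qed simp

lemma lipschitz_minorant_lipschitz:
  assumes "x \<le> y"
  shows "lipschitz_minorant L U y \<le> lipschitz_minorant L U x + L * (y - x)"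
proof -
  have "lipschitz_minorant L U y - L * (y - x) \<le> U j + L * max 0 (x - of_int j)" for j
  proof -
    have "lipschitz_minorant L U y \<le> U j + L * max 0 (y - of_int j)"
      unfolding lipschitz_minorant_def by (intro cINF_lower minorant_bdd) auto
    also have "L * max 0 (y - of_int j) \<le> L * (max 0 (x - of_int j) + (y - x))"
      using L assms by (intro mult_left_mono) auto
    finally show ?thesis by (simp add: algebra_simps)
  qed
  then have "lipschitz_minorant L U y - L * (y - x) \<le> lipschitz_minorant L U x"
    unfolding lipschitz_minorant_def[of L U x] by (intro cINF_greatest) auto
  then show ?thesis by simp
qed

lemma continuous_on_lipschitz_minorant: "continuous_on UNIV (lipschitz_minorant L U)"
proof (rule lipschitz_on_continuous_on[where L = L])
  show "L-lipschitz_on UNIV (lipschitz_minorant L U)"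
  proof (rule lipschitz_onI)
    fix x y :: real
    show "dist (lipschitz_minorant L U x) (lipschitz_minorant L U y) \<le> L * dist x y"
      using lipschitz_minorant_mono[of x y] lipschitz_minorant_lipschitz[of x y]
        lipschitz_minorant_mono[of y x] lipschitz_minorant_lipschitz[of y x]
      by (cases "x \<le> y") (auto simp: dist_real_def)
  qed (fact L)
qed

end

section \<open>Slowly growing functions\<close>

text \<open>In the variable \<open>t = exp x\<close> the sum is that of the quotients
  \<open>p / q\<close> over disjoint intervals \<open>[p, q]\<close>, on each of which
  \<open>H\<close> rises by at least \<open>b\<close>.\<close>

definition slow :: "real \<Rightarrow> real \<Rightarrow> (real \<Rightarrow> real) \<Rightarrow> bool" where
  "slow b B H \<longleftrightarrow>
     (\<forall>I x y. ordered_intervals I x y \<longrightarrow> (\<forall>i\<in>I. b \<le> H (y i) - H (x i)) \<longrightarrow>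
        (\<Sum>i\<in>I. exp (x i - y i)) \<le> B)"

lemma slowD:
  assumes "slow b B H" "ordered_intervals I x y" "\<And>i. i \<in> I \<Longrightarrow> b \<le> H (y i) - H (x i)"
  shows "(\<Sum>i\<in>I. exp (x i - y i)) \<le> B"
  using assms unfolding slow_def by blast

text \<open>If \<open>G + H\<close> rises by \<open>b + c\<close>, then \<open>G\<close> rises by
  \<open>b\<close> or \<open>H\<close> rises by \<open>c\<close>; the intervals are sorted
  accordingly.\<close>

lemma slow_add:
  assumes "slow b B G" "slow c C H"
  shows "slow (b + c) (B + C) (\<lambda>x. G x + H x)"
  unfolding slow_def
proof (intro allI impI)
  fix I x y assume ord: "ordered_intervals I x y"
    and inc: "\<forall>i\<in>I. b + c \<le> G (y i) + H (y i) - (G (x i) + H (x i))"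
  define J where "J = {i \<in> I. b \<le> G (y i) - G (x i)}"
  have "finite I" using ord by (simp add: ordered_intervals_def)
  have J: "(\<Sum>i\<in>J. exp (x i - y i)) \<le> B"
    using assms(1) ordered_intervals_subset[OF ord] by (rule slowD) (auto simp: J_def)
  have "(\<Sum>i\<in>I - J. exp (x i - y i)) \<le> C"
    using assms(2) ordered_intervals_subset[OF ord]
    by (rule slowD) (use inc in \<open>fastforce simp: J_def\<close>)+
  moreover have "(\<Sum>i\<in>I. exp (x i - y i)) = (\<Sum>i\<in>J. exp (x i - y i)) + (\<Sum>i\<in>I - J. exp (x i - y i))"
    using \<open>finite I\<close> by (metis (lifting) J_def add.commute mem_Collect_eq subsetI sum.subset_diff)
  ultimately show "(\<Sum>i\<in>I. exp (x i - y i)) \<le> B + C"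
    using J by linarith
qed

lemma telescope_le:
  fixes g :: "real \<Rightarrow> real"
  assumes "ordered_intervals I x y" "\<And>s t. s \<le> t \<Longrightarrow> g s \<le> g t" "\<And>s. \<bar>g s\<bar> \<le> M"
  shows "(\<Sum>i\<in>I. g (y i) - g (x i)) \<le> 2 * M"
proof -
  have fin: "finite I" using assms(1) by (simp add: ordered_intervals_def)
  \<comment> \<open>The bound by \<open>g z + M\<close>, for every \<open>z\<close> to the right of
    the intervals so far, lets the induction pass over the gap before the next interval.\<close>
  have "J \<subseteq> I \<Longrightarrow> (\<forall>z. (\<forall>i\<in>J. y i \<le> z) \<longrightarrow> (\<Sum>i\<in>J. g (y i) - g (x i)) \<le> g z + M)"
    if "finite J" for J
    using that
  proof (induction rule: finite_linorder_max_induct)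
    case empty
    have "0 \<le> g z + M" for z using assms(3)[of z] by simp
    then show ?case by simp
  next
    case (insert k J)
    have "y i \<le> x k" if "i \<in> J" for i
      using assms(1) insert that unfolding ordered_intervals_def by blast
    then have "(\<Sum>i\<in>J. g (y i) - g (x i)) \<le> g (x k) + M" using insert by blast
    moreover have "k \<notin> J" using insert by blast
    ultimately show ?case using insert(1) assms(2)[of "y k"] by fastforce
  qed
  from this[OF fin]
  have "(\<Sum>i\<in>I. g (y i) - g (x i)) \<le> g (Max (insert 0 (y ` I))) + M"
    using fin by auto
  then show ?thesis using assms(3)[of "Max (insert 0 (y ` I))"] by simp
qed

text \<open>With \<open>u = cosh a\<close>, the left side is at most \<open>8 / u\<^sup>2\<close>,
  because \<open>sinh b - sinh a\<close> is at least \<open>u / 2\<close>, and the increment of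
  \<open>tanh\<close> is at least \<open>3 / (8 * u\<^sup>2)\<close>. The point is that increments
  of the bounded monotone function \<open>tanh\<close> can be summed over disjoint
  intervals.\<close>

lemma exp_sinh_diff_le:
  fixes a b :: real
  assumes "ln 2 \<le> b - a"
  shows "exp (sinh a - sinh b) \<le> 64 / 3 * (tanh b - tanh a)"
proof -
  define d where "d = b - a"
  have b: "b = a + d" by (simp add: d_def)
  have d: "ln 2 \<le> d" using assms by (simp add: d_def)
  then have d0: "0 < d" using ln_gt_zero[of "2::real"] by linarith
  have ed: "2 \<le> exp d" using exp_le_cancel_iff[of "ln 2" d] d by simp
  then have emd: "exp (- d) \<le> 1 / 2" by (simp add: exp_minus field_simps)
  define u where "u = cosh a"
  have u: "1 \<le> u" by (simp add: u_def cosh_real_ge_1)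
  have "sinh b - sinh a = (exp a * (exp d - 1) + exp (- a) * (1 - exp (- d))) / 2"
    by (simp add: b sinh_field_def exp_add exp_diff exp_minus field_simps)
  moreover have "exp a * (1 / 2) \<le> exp a * (exp d - 1)" "exp (- a) * (1 / 2) \<le> exp (- a) * (1 - exp (- d))"
    using ed emd by (intro mult_left_mono; simp)+
  moreover have "u / 2 = (exp a * (1 / 2) + exp (- a) * (1 / 2)) / 2"
    by (simp add: u_def cosh_field_def)
  ultimately have "u / 2 \<le> sinh b - sinh a" by argo
  then have "exp (sinh a - sinh b) \<le> exp (- (u / 2))" by simp
  also have "\<dots> \<le> 8 / u\<^sup>2"
  proof -
    have "1 + u / 2 + (u / 2)\<^sup>2 / 2 \<le> exp (u / 2)"
      using u by (intro exp_lower_Taylor_quadratic) auto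
    then have "u\<^sup>2 / 8 \<le> exp (u / 2)" using u by (simp add: power2_eq_square)
    then show ?thesis using u by (simp add: exp_minus field_simps)
  qed
  also have "\<dots> = 64 / 3 * ((1 - 1 / 4) / (2 * u\<^sup>2))" using u by simp
  \<comment> \<open>The increment is \<open>sinh d / (cosh b * u)\<close> with
    \<open>cosh b \<le> exp d * u\<close>, and
    \<open>sinh d / exp d = (1 - exp (- 2 * d)) / 2\<close>, where
    \<open>exp (- d) \<le> 1 / 2\<close>.\<close>
  also have "(1 - 1 / 4) / (2 * u\<^sup>2) \<le> tanh b - tanh a"
  proof -
    have cosh: "cosh b \<le> exp d * u"
    proof -
      have "exp (- a - d) \<le> exp (d - a)" using d0 by simp
      then show ?thesis by (simp add: b u_def cosh_field_def exp_add[symmetric] algebra_simps)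
    qed
    have "tanh b - tanh a = sinh (b - a) / (cosh b * cosh a)"
      using cosh_real_pos[of a] cosh_real_pos[of b]
      by (simp add: tanh_def sinh_diff field_simps)
    then have eq: "tanh b - tanh a = sinh d / (cosh b * u)" by (simp add: d_def u_def)
    have "(1 - 1 / 4) / (2 * u\<^sup>2) \<le> (1 - exp (- d) * exp (- d)) / (2 * u\<^sup>2)"
      using emd mult_mono[OF emd emd] u by (intro divide_right_mono) auto
    also have "\<dots> = sinh d / (exp d * u * u)"
      by (simp add: sinh_field_def exp_minus power2_eq_square field_simps)
    also have "\<dots> \<le> sinh d / (cosh b * u)"
      using cosh u d0 cosh_real_pos[of b]
      by (intro divide_left_mono mult_right_mono mult_pos_pos) auto
    finally show ?thesis by (simp add: eq)
  qed
  finally show ?thesis by simp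
qed

text \<open>Each interval is charged to an increment of \<open>tanh (arsinh x)\<close>; these add up
  to at most 2, which doubles the constant 64/3.\<close>

lemma slow_arsinh: "slow (ln 2) (128 / 3) (arsinh :: real \<Rightarrow> real)"
  unfolding slow_def
proof (intro allI impI)
  fix I and x y :: "nat \<Rightarrow> real"
  assume ord: "ordered_intervals I x y" and inc: "\<forall>i\<in>I. ln 2 \<le> arsinh (y i) - arsinh (x i)"
  have "exp (x i - y i) \<le> 64 / 3 * (tanh (arsinh (y i)) - tanh (arsinh (x i)))" if "i \<in> I" for i
    using exp_sinh_diff_le[of "arsinh (y i)" "arsinh (x i)"] inc that by simp
  then have "(\<Sum>i\<in>I. exp (x i - y i)) \<le> (\<Sum>i\<in>I. 64 / 3 * (tanh (arsinh (y i)) - tanh (arsinh (x i))))"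
    by (intro sum_mono)
  also have "\<dots> = 64 / 3 * (\<Sum>i\<in>I. tanh (arsinh (y i)) - tanh (arsinh (x i)))"
    by (simp add: sum_distrib_left)
  also have "(\<Sum>i\<in>I. tanh (arsinh (y i)) - tanh (arsinh (x i))) \<le> 2 * 1"
    using ord
  proof (rule telescope_le)
    show "tanh (arsinh s) \<le> tanh (arsinh t)" if "s \<le> t" for s t :: real
      using that by (auto simp: le_less arsinh_real_strict_mono)
    show "\<bar>tanh (arsinh s)\<bar> \<le> 1" for s :: real
      using tanh_real_bounds[of "arsinh s"] by (auto simp: abs_le_iff)
  qed
  finally show "(\<Sum>i\<in>I. exp (x i - y i)) \<le> 128 / 3" by simp
qed

text \<open>Comparing the minorant with \<open>bi_up\<close> at the floors loses at most
  \<open>L\<close>, and the extra 1 makes the remaining rise exceed \<open>8 * c\<close> strictly.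
  So \<open>f\<close> rises by more than \<open>2 * c\<close> on an integer interval between the
  floors. Rounding down costs at most 1 in the exponent, hence the factor
  \<open>exp 1\<close>.\<close>

lemma slow_lipschitz_minorant:
  assumes c: "0 \<le> c" and L: "0 \<le> L" and step: "\<And>j. f (j + 1) - f j \<le> L"
    and up: "\<And>I p q. ordered_intervals I p q \<Longrightarrow> (\<And>i. i \<in> I \<Longrightarrow> 2 * c < f (q i) - f (p i)) \<Longrightarrow>
        (\<Sum>i\<in>I. exp (of_int (p i) - of_int (q i))) \<le> B"
  shows "slow (8 * c + L + 1) (exp 1 * B) (lipschitz_minorant L (bi_up c f))"
  unfolding slow_def
proof (intro allI impI)
  fix I and x y :: "nat \<Rightarrow> real"
  let ?E = "lipschitz_minorant L (bi_up c f)"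
  assume ord: "ordered_intervals I x y" and inc: "\<forall>i\<in>I. 8 * c + L + 1 \<le> ?E (y i) - ?E (x i)"
  have "\<exists>p q. \<lfloor>x i\<rfloor> \<le> p \<and> p < q \<and> q \<le> \<lfloor>y i\<rfloor> \<and> 2 * c < f q - f p" if i: "i \<in> I" for i
  proof -
    have "bi_up c f \<lfloor>x i\<rfloor> \<le> ?E (x i)" "?E (y i) \<le> bi_up c f \<lfloor>y i\<rfloor> + L"
      using L bi_up_mono bi_up_step[of c L f, OF c L step]
      by (auto intro!: lipschitz_minorant_ge lipschitz_minorant_le)
    with inc i have "8 * c < bi_up c f \<lfloor>y i\<rfloor> - bi_up c f \<lfloor>x i\<rfloor>" by force
    moreover have "\<lfloor>x i\<rfloor> \<le> \<lfloor>y i\<rfloor>"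
      using ord i by (intro floor_mono) (auto simp: ordered_intervals_def)
    ultimately obtain p q where pq: "\<lfloor>x i\<rfloor> \<le> p" "p \<le> q" "q \<le> \<lfloor>y i\<rfloor>" "2 * c < f q - f p"
      using bi_up_increase[OF c] by blast
    then have "p \<noteq> q" using c by auto
    with pq show ?thesis by force
  qed
  then obtain p q where pq: "\<And>i. i \<in> I \<Longrightarrow> \<lfloor>x i\<rfloor> \<le> p i" "\<And>i. i \<in> I \<Longrightarrow> p i < q i"
    "\<And>i. i \<in> I \<Longrightarrow> q i \<le> \<lfloor>y i\<rfloor>" "\<And>i. i \<in> I \<Longrightarrow> 2 * c < f (q i) - f (p i)"
    by metis
  have "q i \<le> p j" if "i \<in> I" "j \<in> I" "i < j" for i j
  proof -
    have "\<lfloor>y i\<rfloor> \<le> \<lfloor>x j\<rfloor>" using ord that by (intro floor_mono) (auto simp: ordered_intervals_def)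
    then show ?thesis using pq(1)[of j] pq(3)[of i] that by linarith
  qed
  then have "ordered_intervals I p q" using ord pq(2) by (simp add: ordered_intervals_def)
  then have "(\<Sum>i\<in>I. exp (of_int (p i) - of_int (q i))) \<le> B" using up pq(4) by blast
  moreover have "exp (x i - y i) \<le> exp 1 * exp (of_int (p i) - of_int (q i))" if "i \<in> I" for i
  proof -
    have "x i - y i \<le> 1 + (of_int (p i) - of_int (q i))"
      using pq(1)[OF that] pq(3)[OF that] by linarith
    then show ?thesis by (simp flip: exp_add)
  qed
  then have "(\<Sum>i\<in>I. exp (x i - y i)) \<le> exp 1 * (\<Sum>i\<in>I. exp (of_int (p i) - of_int (q i)))"
    by (auto simp: sum_distrib_left intro: sum_mono)
  ultimately show "(\<Sum>i\<in>I. exp (x i - y i)) \<le> exp 1 * B"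
    by (meson exp_ge_zero mult_left_mono order_trans)
qed

section \<open>Monotone weights from slowly growing functions\<close>

lemma integral_pos_of_continuous_pos:
  fixes f :: "real \<Rightarrow> real"
  assumes "continuous_on {0<..} f" "\<And>x. 0 < x \<Longrightarrow> 0 < f x" "0 < s" "s < t"
  shows "0 < integral {s..t} f"
proof -
  have cont: "continuous_on {s..t} f"
    using assms by (auto intro: continuous_on_subset)
  have nonneg: "0 \<le> f x" if "x \<in> {s..t}" for x
    using assms(2)[of x] assms(3) that by simp
  have "integral {s..t} f \<noteq> 0"
    using integral_eq_0_iff[OF cont \<open>s < t\<close> nonneg] assms(2)[of s] assms(3,4) by force
  moreover have "0 \<le> integral {s..t} f"
    using nonneg by (intro integral_nonneg integrable_continuous_interval cont) auto
  ultimately show ?thesis by simp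
qed

text \<open>The dominating \<open>g\<close> gives integrability near 0, and the lower bound on
  \<open>[1, t]\<close> gives \<open>W(t) \<ge> (t - 1) * k t\<close>. As \<open>k\<close> may
  depend on \<open>t\<close>, weights that decay to 0 are covered.\<close>

lemma weight_functionI:
  assumes cont: "continuous_on {0<..} w" and pos: "\<And>x. 0 < x \<Longrightarrow> 0 < w x"
    and dom: "\<And>t. 0 < t \<Longrightarrow> \<exists>g. g integrable_on {0<..t} \<and> (\<forall>x\<in>{0<..t}. w x \<le> g x)"
    and lower: "\<And>t x. 1 \<le> x \<Longrightarrow> x \<le> t \<Longrightarrow> k t \<le> w x"
    and k: "filterlim (\<lambda>t. (t - 1) * k t) at_top at_top"
  shows "weight_function w"
proof -
  have int: "set_integrable lebesgue {0<..t} w" if t: "0 < t" for t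
  proof -
    obtain g where g: "g integrable_on {0<..t}" "\<And>x. x \<in> {0<..t} \<Longrightarrow> w x \<le> g x"
      using dom[OF t] by blast
    show ?thesis
    proof (rule measurable_bounded_by_integrable_imp_absolutely_integrable[OF _ _ g(1)])
      show "w \<in> borel_measurable (lebesgue_on {0<..t})"
        by (intro continuous_imp_measurable_on_sets_lebesgue continuous_on_subset[OF cont]) auto
      show "norm (w x) \<le> g x" if "x \<in> {0<..t}" for x
        using g(2)[OF that] pos[of x] that by simp
    qed simp
  qed
  \<comment> \<open>The value \<open>w 0\<close> is arbitrary; closed intervals differ from
    half-open ones only by this null set.\<close>
  have spike: "negligible ({0<..t} - {0..t} \<union> ({0..t} - {0<..t}))" for t :: real
    by (rule negligible_subset[of "{0}"]) auto
  have hk: "w integrable_on {0..t}" for t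
  proof (cases "0 < t")
    case True
    then show ?thesis
      using set_lebesgue_integral_eq_integral(1)[OF int] integrable_spike_set_eq[OF spike] by blast
  next
    case False
    then show ?thesis using integrable_on_refl[of w 0] by (cases "t = 0") auto
  qed
  have eq: "weight_integral w t = integral {0..t} w" for t
  proof (cases "0 < t")
    case True
    then show ?thesis
      using set_lebesgue_integral_eq_integral(2)[OF int]
      by (simp add: weight_integral_def,
          intro integral_spike_set) (auto intro: negligible_subset[OF spike[of t]])
  next
    case False
    then show ?thesis by (cases "t = 0") (auto simp: weight_integral_def set_lebesgue_integral_def)
  qed
  have hk_sub: "w integrable_on {s..t}" if "0 \<le> s" for s t
    using integrable_subinterval_real[OF hk, of s t t] that by auto
  have add: "weight_integral w s + integral {s..t} w = weight_integral w t" if "0 \<le> s" "s \<le> t" for s t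
    using Henstock_Kurzweil_Integration.integral_combine[OF that hk] by (simp add: eq)
  have nonneg: "0 \<le> integral {s..t} w" if "0 \<le> s" for s t
  proof -
    have "integral ({s..t} - {0}) w = integral {s..t} w"
      by (rule integral_spike_set) (auto intro: negligible_subset[of "{0}"])
    moreover have "0 \<le> integral ({s..t} - {0}) w"
    proof (rule integral_nonneg)
      show "w integrable_on {s..t} - {0}"
        by (rule integrable_spike_set[OF hk_sub[OF that, of t]]) (auto intro: negligible_subset[of "{0}"])
      show "0 \<le> w x" if "x \<in> {s..t} - {0}" for x
        using pos[of x] that \<open>0 \<le> s\<close> by force
    qed
    ultimately show ?thesis by simp
  qed
  have "phi_function (weight_integral w)"
    unfolding phi_function_def
  proof (intro conjI)
    show "weight_integral w ` {0..} \<subseteq> {0..}"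
      using nonneg by (auto simp: eq)
    show "weight_integral w 0 = 0" by (simp add: eq)
    show "strict_mono_on {0..} (weight_integral w)"
    proof (rule strict_mono_onI)
      fix s t :: real assume "s \<in> {0..}" "s < t"
      then have st: "0 \<le> s" "s < t" by auto
      \<comment> \<open>The weight is known to be continuous and positive only away from 0, and
        \<open>s\<close> may be 0; so positivity is taken from the upper half of the
        interval.\<close>
      define m where "m = (s + t) / 2"
      have m: "s < m" "m < t" "0 < m" using st by (auto simp: m_def)
      have "0 < integral {m..t} w"
        using cont pos m by (intro integral_pos_of_continuous_pos) auto
      then show "weight_integral w s < weight_integral w t"
        using add[of s m] add[of m t] nonneg[of s m] st m by simp
    qed
    show "continuous_on {0..} (weight_integral w)"
      unfolding continuous_on_eq_continuous_within
    proof
      fix x :: real assume "x \<in> {0..}"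
      have "continuous_on {0..x + 1} (weight_integral w)"
        using indefinite_integral_continuous_1[OF hk] by (simp add: eq[abs_def])
      then have "continuous (at x within {0..x + 1}) (weight_integral w)"
        using \<open>x \<in> {0..}\<close> by (auto simp: continuous_on_eq_continuous_within)
      moreover have "at x within {0..} = at x within {0..x + 1}"
        by (rule at_within_nhd[of _ "{..<x + 1}"]) auto
      ultimately show "continuous (at x within {0..}) (weight_integral w)"
        by (simp add: continuous_within)
    qed
    show "filterlim (weight_integral w) at_top at_top"
    proof (rule filterlim_at_top_mono[OF k])
      show "\<forall>\<^sub>F t in at_top. (t - 1) * k t \<le> weight_integral w t"
        using eventually_ge_at_top[of 1]
      proof eventually_elim
        case (elim t)
        have "integral {1..t} (\<lambda>_. k t) \<le> integral {1..t} w"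
          using elim lower by (intro integral_le hk_sub) auto
        then show ?case using add[of 1 t] nonneg[of 0 1] elim by (simp add: eq)
      qed
    qed
  qed
  then show ?thesis
    using int pos by (auto simp: weight_function_def)
qed

text \<open>\<open>A\<close> is the logarithm of a weight in the variable \<open>ln t\<close>:
  \<open>exp (A (ln t))\<close> will be the increasing weight, and the reciprocal of such a function
  the decreasing one.\<close>

locale slow_bijection =
  fixes A :: "real \<Rightarrow> real" and b B :: real
  assumes b: "0 < b" and slow: "slow b B A"
    and cont: "continuous_on UNIV A" and smono: "strict_mono A"
    and top: "filterlim A at_top at_top" and bot: "filterlim A at_bot at_bot"
begin

lemma surj: "\<exists>x. A x = v"
proof -
  have "\<forall>\<^sub>F x in at_top. v \<le> A x" using top by (simp add: filterlim_at_top)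
  then obtain x where x: "v \<le> A x" by (auto simp: eventually_at_top_linorder)
  have "\<forall>\<^sub>F y in at_bot. A y \<le> v" using bot by (simp add: filterlim_at_bot)
  then obtain y where y: "A y \<le> v" by (auto simp: eventually_at_bot_linorder)
  have "y \<le> x" using x y strict_mono_less_eq[OF smono] order_trans by blast
  then show ?thesis
    using IVT'[of A y v x] x y continuous_on_subset[OF cont, of "{y..x}"] by auto
qed

definition G :: "real \<Rightarrow> real" where "G = inv A"

lemma A_G [simp]: "A (G v) = v"
  using someI_ex[OF surj, of v] by (simp add: G_def inv_def)

lemma G_A [simp]: "G (A x) = x"
  using strict_mono_imp_inj_on[OF smono] by (simp add: G_def)

lemma G_less_iff [simp]: "G u < G v \<longleftrightarrow> u < v"
  using strict_mono_less[OF smono, of "G u" "G v"] by simp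

lemma G_le_iff [simp]: "G u \<le> G v \<longleftrightarrow> u \<le> v"
  using strict_mono_less_eq[OF smono, of "G u" "G v"] by simp

lemma A_le_iff: "A x \<le> A y \<longleftrightarrow> x \<le> y" and A_less_iff: "A x < A y \<longleftrightarrow> x < y"
  using strict_mono_less_eq[OF smono] strict_mono_less[OF smono] by auto

text \<open>Slowness applied to the intervals between consecutive levels of \<open>A\<close>, on
  each of which \<open>A\<close> rises by exactly \<open>b\<close>. The bound is uniform in the
  first level and in the number of levels.\<close>

lemma level_sum: "(\<Sum>i<n. exp (G (v + real i * b) - G (v + real (Suc i) * b))) \<le> B"
  using slow
proof (rule slowD)
  show "ordered_intervals {..<n} (\<lambda>i. G (v + real i * b)) (\<lambda>i. G (v + real (Suc i) * b))"
    using b by (auto simp: ordered_intervals_def intro!: mult_right_mono)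
qed (simp add: algebra_simps)

text \<open>The tangent line inequality \<open>e\<^sup>-\<^sup>g \<ge> e\<^sup>-\<^sup>2\<^sup>b (1 + 2 b - g)\<close> turns the bound for the sum
  over the gaps \<open>g\<close> between consecutive levels into a bound for the number of levels.\<close>

lemma growth:
  assumes "x \<le> y"
  shows "A y - A x \<le> (y - x) / 2 + (b + b * B * exp (2 * b))"
proof -
  define n where "n = nat \<lfloor>(A y - A x) / b\<rfloor>"
  define z where "z i = G (A x + real i * b)" for i
  have "0 \<le> (A y - A x) / b" using assms b A_le_iff by simp
  then have n: "real n \<le> (A y - A x) / b" "(A y - A x) / b \<le> real n + 1"
    unfolding n_def by linarith+
  then have n': "real n * b \<le> A y - A x" "A y - A x \<le> (real n + 1) * b"
    using b by (simp_all add: field_simps)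
  have z0: "z 0 = x" by (simp add: z_def)
  have zn: "z n \<le> y" using n' G_le_iff[of "A x + real n * b" "A y"] by (simp add: z_def)
  have "exp (- 2 * b) * (1 + 2 * b - (z (Suc i) - z i)) \<le> exp (z i - z (Suc i))" for i
  proof -
    have "1 + (2 * b - (z (Suc i) - z i)) \<le> exp (2 * b - (z (Suc i) - z i))"
      by (rule exp_ge_add_one_self)
    then have "exp (- 2 * b) * (1 + (2 * b - (z (Suc i) - z i)))
        \<le> exp (- 2 * b) * exp (2 * b - (z (Suc i) - z i))"
      by (intro mult_left_mono) auto
    then show ?thesis by (simp flip: exp_add add: algebra_simps)
  qed
  then have "(\<Sum>i<n. exp (- 2 * b) * (1 + 2 * b - (z (Suc i) - z i))) \<le> (\<Sum>i<n. exp (z i - z (Suc i)))"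
    by (rule sum_mono)
  also have "\<dots> \<le> B" using level_sum[of "A x" n] by (simp add: z_def)
  finally have "exp (- 2 * b) * (real n * (1 + 2 * b) - (z n - z 0)) \<le> B"
    unfolding sum_distrib_left[symmetric] sum_subtractf[of "\<lambda>_. 1 + 2 * b"]
    by (simp add: sum_lessThan_telescope del: sum_subtractf)
  then have "exp (2 * b) * (exp (- 2 * b) * (real n * (1 + 2 * b) - (z n - z 0))) \<le> exp (2 * b) * B"
    by (intro mult_left_mono) auto
  then have "real n * (1 + 2 * b) - (z n - z 0) \<le> B * exp (2 * b)"
    by (simp add: mult.commute flip: mult.assoc exp_add)
  with z0 zn have le: "real n * (1 + 2 * b) \<le> (y - x) + B * exp (2 * b)" by linarith
  have "0 \<le> B" using level_sum[of 0 0] by simp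
  \<comment> \<open>The slope 1/2 comes from \<open>b / (1 + 2 * b) \<le> 1 / 2\<close>.\<close>
  have "(real n * (1 + 2 * b)) * b \<le> ((y - x) + B * exp (2 * b)) * b"
    using le b by (intro mult_right_mono) auto
  also have "\<dots> \<le> ((y - x) / 2) * (1 + 2 * b) + b * B * exp (2 * b) * (1 + 2 * b)"
  proof -
    have "0 \<le> b * B * exp (2 * b) * (2 * b)" using b \<open>0 \<le> B\<close> by simp
    moreover have eq: "((y - x) / 2) * (1 + 2 * b) + b * B * exp (2 * b) * (1 + 2 * b)
        = ((y - x) + B * exp (2 * b)) * b + (y - x) / 2 + b * B * exp (2 * b) * (2 * b)"
      by (simp add: field_simps)
    ultimately show ?thesis
      using assms unfolding eq by (intro add_increasing2 order_refl) auto
  qed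
  also have "\<dots> = ((y - x) / 2 + b * B * exp (2 * b)) * (1 + 2 * b)"
    by (simp add: algebra_simps)
  finally have "real n * b \<le> (y - x) / 2 + b * B * exp (2 * b)"
    using b mult_le_cancel_right_pos[of "1 + 2 * b" "real n * b"] by (simp add: mult_ac)
  with n' show ?thesis by (simp add: algebra_simps)
qed

text \<open>Cut the half-line at the points \<open>\<tau> n\<close> where \<open>A (ln t)\<close>
  equals \<open>n * b\<close>. On \<open>[\<tau> n, \<tau> (n + 1))\<close> the shift by
  \<open>2 * b\<close> leads at least to level \<open>n + 2\<close>, so this piece contributes at
  most \<open>\<tau> (n + 1) / \<tau> (n + 2)\<close>, a term of \<open>level_sum\<close>. A shift
  by \<open>b\<close> alone would leave only the bound 1 per piece.\<close>

lemma shift_integral_finite: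
  "(\<integral>\<^sup>+ t. ennreal (1 / exp (G (A (ln t) + 2 * b))) \<partial>lebesgue_on {0<..}) < \<infinity>"
proof -
  define \<tau> where "\<tau> n = exp (G (of_int n * b))" for n :: int
  have \<tau>0: "0 < \<tau> n" for n by (simp add: \<tau>_def)
  define J where "J n t = ennreal (1 / \<tau> (n + 2)) * indicator {\<tau> n..<\<tau> (n + 1)} t" for n t
  have J: "(\<integral>\<^sup>+ t. J n t \<partial>lebesgue) \<le> ennreal (\<tau> (n + 1) / \<tau> (n + 2))" for n
  proof -
    have le: "\<tau> n \<le> \<tau> (n + 1)" using b by (simp add: \<tau>_def)
    have "(\<integral>\<^sup>+ t. J n t \<partial>lebesgue) = ennreal (1 / \<tau> (n + 2)) * ennreal (\<tau> (n + 1) - \<tau> n)"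
      unfolding J_def using le by (subst nn_integral_cmult_indicator) auto
    also have "\<dots> = ennreal ((\<tau> (n + 1) - \<tau> n) / \<tau> (n + 2))"
      using le \<tau>0[of "n + 2"] by (simp flip: ennreal_mult')
    also have "\<dots> \<le> ennreal (\<tau> (n + 1) / \<tau> (n + 2))"
      using \<tau>0 by (intro ennreal_leI divide_right_mono) (auto simp: less_imp_le)
    finally show ?thesis .
  qed
  have J_meas [measurable]: "J n \<in> borel_measurable lebesgue" for n
    unfolding J_def by (intro borel_measurable_times_ennreal borel_measurable_indicator) auto
  have pos: "(\<Sum>k<N. \<tau> (int k + 1) / \<tau> (int k + 2)) \<le> B" for N
    using level_sum[of b N] by (simp add: \<tau>_def exp_diff algebra_simps)
  \<comment> \<open>The pieces with negative index \<open>n = - k - 1\<close> are met in descending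
    order; reversing the finite sum makes them an ascending run of levels starting at
    \<open>- (N - 1) * b\<close>.\<close>
  have neg: "(\<Sum>k<N. \<tau> (- int k) / \<tau> (- int k + 1)) \<le> B" for N
  proof -
    have "(\<Sum>k<N. \<tau> (- int k) / \<tau> (- int k + 1)) = (\<Sum>k<N. \<tau> (- int (N - Suc k)) / \<tau> (- int (N - Suc k) + 1))"
      by (rule sum.nat_diff_reindex[symmetric])
    also have "\<dots> = (\<Sum>i<N. exp (G (- (real N - 1) * b + real i * b) - G (- (real N - 1) * b + real (Suc i) * b)))"
      by (intro sum.cong refl) (simp add: \<tau>_def exp_diff of_nat_diff algebra_simps)
    also have "\<dots> \<le> B" by (rule level_sum)
    finally show ?thesis .
  qed
  have bound: "(\<integral>\<^sup>+ t. (\<Sum>k. J (m k) t) \<partial>lebesgue) \<le> ennreal B"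
    if "\<And>N. (\<Sum>k<N. \<tau> (m k + 1) / \<tau> (m k + 2)) \<le> B" for m :: "nat \<Rightarrow> int"
  proof -
    have "(\<integral>\<^sup>+ t. (\<Sum>k. J (m k) t) \<partial>lebesgue) = (\<Sum>k. (\<integral>\<^sup>+ t. J (m k) t \<partial>lebesgue))"
      by (rule nn_integral_suminf) measurable
    also have "\<dots> \<le> (\<Sum>k. ennreal (\<tau> (m k + 1) / \<tau> (m k + 2)))"
      by (intro suminf_le J summableI)
    also have "\<dots> \<le> ennreal B"
      using that \<tau>0 by (intro suminf_le_const summableI) (simp add: sum_ennreal less_imp_le ennreal_leI)
    finally show ?thesis .
  qed
  have "ennreal (1 / exp (G (A (ln t) + 2 * b))) * indicator {0<..} t
      \<le> (\<Sum>k. J (int k) t) + (\<Sum>k. J (- int k - 1) t)" for t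
  proof (cases "0 < t")
    case True
    define n where "n = \<lfloor>A (ln t) / b\<rfloor>"
    have "of_int n \<le> A (ln t) / b" "A (ln t) / b < of_int n + 1"
      by (simp_all add: n_def)
    then have n: "of_int n * b \<le> A (ln t)" "A (ln t) < (of_int n + 1) * b"
      using b by (simp_all add: field_simps)
    have "\<tau> n \<le> t" "t < \<tau> (n + 1)"
      using n G_le_iff[of "of_int n * b" "A (ln t)"] G_less_iff[of "A (ln t)" "(of_int n + 1) * b"] True
      unfolding \<tau>_def by (metis G_A exp_le_cancel_iff exp_ln of_int_1 of_int_add,
          metis G_A exp_less_cancel_iff exp_ln of_int_1 of_int_add)
    moreover have "\<tau> (n + 2) \<le> exp (G (A (ln t) + 2 * b))"
      using n by (simp add: \<tau>_def algebra_simps)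
    then have "1 / exp (G (A (ln t) + 2 * b)) \<le> 1 / \<tau> (n + 2)"
      using \<tau>0 by (intro divide_left_mono) auto
    ultimately have le: "ennreal (1 / exp (G (A (ln t) + 2 * b))) * indicator {0<..} t \<le> J n t"
      using True by (simp add: J_def ennreal_leI)
    have single: "f k \<le> (\<Sum>k. f k)" for f :: "nat \<Rightarrow> ennreal" and k
      using sum_le_suminf[OF summableI, of "{k}" f] by simp
    show ?thesis
    proof (cases "0 \<le> n")
      case True
      then have "J n t \<le> (\<Sum>k. J (int k) t)" using single[of "\<lambda>k. J (int k) t" "nat n"] by simp
      with le show ?thesis by (meson add_increasing2 order_trans zero_le)
    next
      case False
      then have "J n t \<le> (\<Sum>k. J (- int k - 1) t)"
        using single[of "\<lambda>k. J (- int k - 1) t" "nat (- n - 1)"] by simp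
      with le show ?thesis by (meson add_increasing order_trans zero_le)
    qed
  qed simp
  then have "(\<integral>\<^sup>+ t. ennreal (1 / exp (G (A (ln t) + 2 * b))) \<partial>lebesgue_on {0<..})
      \<le> (\<integral>\<^sup>+ t. (\<Sum>k. J (int k) t) + (\<Sum>k. J (- int k - 1) t) \<partial>lebesgue)"
    by (subst nn_integral_restrict_space) (auto intro!: nn_integral_mono)
  also have "\<dots> = (\<integral>\<^sup>+ t. (\<Sum>k. J (int k) t) \<partial>lebesgue) + (\<integral>\<^sup>+ t. (\<Sum>k. J (- int k - 1) t) \<partial>lebesgue)"
    by (rule nn_integral_add) measurable
  also have "\<dots> \<le> ennreal B + ennreal B"
    using pos neg by (intro add_mono bound) (auto simp: add.commute)
  also have "\<dots> < \<infinity>" by (simp add: less_top)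
  finally show ?thesis .
qed

section \<open>The increasing and the decreasing weight of a slow bijection\<close>

lemma continuous_on_A_ln: "continuous_on {0<..} (\<lambda>t. A (ln t))"
  by (rule continuous_on_compose2[OF cont]) (auto intro!: continuous_intros)

lemma bij_increasing: "bij_betw (\<lambda>t. exp (A (ln t))) {0<..} {0<..}"
  by (rule bij_betw_byWitness[where f' = "\<lambda>s. exp (G (ln s))"]) auto

lemma bij_decreasing: "bij_betw (\<lambda>t. exp (- A (ln t))) {0<..} {0<..}"
  by (rule bij_betw_byWitness[where f' = "\<lambda>s. exp (G (- ln s))"]) auto

text \<open>Multiplying the weight by \<open>exp (2 * b)\<close> shifts \<open>A\<close> by
  \<open>2 * b\<close>, which gives the integral already bounded.\<close>

lemma condition_L_increasing: "condition_L (\<lambda>t. exp (A (ln t)))"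
proof -
  let ?w = "\<lambda>t. exp (A (ln t))"
  have inv: "inv_into {0<..} ?w (exp (2 * b) * ?w t) = exp (G (A (ln t) + 2 * b))" for t
    using bij_betw_imp_inj_on[OF bij_increasing]
    by (intro inv_into_f_eq) (auto simp flip: exp_add simp: add.commute)
  show ?thesis
    unfolding condition_L_def
  proof (intro conjI exI)
    show "(\<integral>\<^sup>+ t. ennreal (1 / inv_into {0<..} ?w (exp (2 * b) * ?w t)) \<partial>lebesgue_on {0<..}) < \<infinity>"
      unfolding inv by (rule shift_integral_finite)
  qed (auto intro: bij_increasing)
qed

text \<open>Because of the sign in the exponent, the factor \<open>exp (- 2 * b)\<close> produces
  the same upward shift of \<open>A\<close>.\<close>

lemma condition_L_decreasing: "condition_L (\<lambda>t. exp (- A (ln t)))"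
proof -
  let ?w = "\<lambda>t. exp (- A (ln t))"
  have inv: "inv_into {0<..} ?w (exp (- 2 * b) * ?w t) = exp (G (A (ln t) + 2 * b))" for t
    using bij_betw_imp_inj_on[OF bij_decreasing]
    by (intro inv_into_f_eq) (auto simp flip: exp_add simp: add.commute)
  show ?thesis
    unfolding condition_L_def
  proof (intro conjI exI)
    show "(\<integral>\<^sup>+ t. ennreal (1 / inv_into {0<..} ?w (exp (- 2 * b) * ?w t)) \<partial>lebesgue_on {0<..}) < \<infinity>"
      unfolding inv by (rule shift_integral_finite)
  qed (auto intro: bij_decreasing)
qed

lemma strictly_monotone_weight_increasing: "strictly_monotone_weight (\<lambda>t. exp (A (ln t)))"
proof -
  let ?w = "\<lambda>t. exp (A (ln t))"
  have mono: "A (ln x) \<le> A (ln y)" if "0 < x" "x \<le> y" for x y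
    using that by (simp add: A_le_iff)
  have lim: "filterlim (\<lambda>t. (t - 1) * ?w 1) at_top at_top"
    by (rule filterlim_at_top_mult_tendsto_pos[OF tendsto_const])
       (auto intro: filterlim_tendsto_add_at_top[OF tendsto_const filterlim_ident, of "-1", simplified])
  have "weight_function ?w"
  proof (rule weight_functionI[where k = "\<lambda>_. ?w 1"])
    show "continuous_on {0<..} ?w" by (intro continuous_intros continuous_on_A_ln)
    \<comment> \<open>The bound is the constant \<open>?w t\<close>, written with
      \<open>x powr 0\<close> to use the integrability of powers.\<close>
    show "\<exists>g. g integrable_on {0<..t} \<and> (\<forall>x\<in>{0<..t}. ?w x \<le> g x)" if "0 < t" for t
      using integrable_on_powr_from_0'[of 0 t] mono that
      by (intro exI[of _ "\<lambda>x. ?w t * x powr 0"] conjI integrable_on_cmult_left) auto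
  qed (use mono[of 1] lim in auto)
  moreover have "strict_mono_on {0<..} ?w"
    by (rule strict_mono_onI) (simp add: A_less_iff)
  moreover have "(?w \<longlongrightarrow> 0) (at_right 0)"
    by (rule filterlim_compose[OF exp_at_bot]) (rule filterlim_compose[OF bot ln_at_0])
  moreover have "filterlim ?w at_top at_top"
    by (rule filterlim_compose[OF exp_at_top]) (rule filterlim_compose[OF top ln_at_top])
  ultimately show ?thesis by (simp add: strictly_monotone_weight_def)
qed

text \<open>By \<open>growth\<close>, \<open>A\<close> rises with slope at most 1/2 up to the
  constant \<open>M\<close>. So the weight is at most a multiple of \<open>x powr (- 1 / 2)\<close>
  near 0, hence integrable there, and decays at infinity no faster than such a power, so its
  integral diverges.\<close>

lemma strictly_monotone_weight_decreasing: "strictly_monotone_weight (\<lambda>t. exp (- A (ln t)))"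
proof -
  let ?w = "\<lambda>t. exp (- A (ln t))"
  define M where "M = b + b * B * exp (2 * b)"
  have powr: "x powr (1 / 2) = exp (ln x / 2)" "x powr (- 1 / 2) = exp (- ln x / 2)" if "0 < x" for x :: real
    using that by (simp_all add: powr_def)
  have upper: "?w x \<le> exp (M + ln t / 2 - A (ln t)) * x powr (- 1 / 2)" if "0 < x" "x \<le> t" for x t
    using growth[of "ln x" "ln t"] that unfolding powr(2)[OF that(1)]
    by (simp add: M_def diff_divide_distrib flip: exp_add)
  have lower: "exp (- M - A 0) * t powr (- 1 / 2) \<le> ?w x" if "1 \<le> x" "x \<le> t" for x t
  proof -
    have "A (ln x) \<le> A (ln t)" using that by (simp add: A_le_iff)
    moreover have "t powr (- 1 / 2) = exp (- ln t / 2)" using that by (intro powr) simp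
    moreover have "A (ln t) - A 0 \<le> ln t / 2 + M" using growth[of 0 "ln t"] that by (simp add: M_def)
    ultimately show ?thesis by (simp flip: exp_add)
  qed
  have lim: "filterlim (\<lambda>t. (t - 1) * (exp (- M - A 0) * t powr (- 1 / 2))) at_top at_top"
    by real_asymp
  have "weight_function ?w"
  proof (rule weight_functionI[where k = "\<lambda>t. exp (- M - A 0) * t powr (- 1 / 2)"])
    show "continuous_on {0<..} ?w" by (intro continuous_intros continuous_on_A_ln)
    show "\<exists>g. g integrable_on {0<..t} \<and> (\<forall>x\<in>{0<..t}. ?w x \<le> g x)" if "0 < t" for t
      using integrable_on_powr_from_0'[of "- 1 / 2" t] upper that
      by (intro exI[of _ "\<lambda>x. exp (M + ln t / 2 - A (ln t)) * x powr (- 1 / 2)"] conjI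
          integrable_on_cmult_left) auto
  qed (use lower lim in auto)
  moreover have "strict_antimono_on {0<..} ?w"
    by (rule monotone_onI) (simp add: A_less_iff)
  moreover have "filterlim ?w at_top (at_right 0)"
    by (rule filterlim_compose[OF exp_at_top], subst filterlim_uminus_at_top, simp)
       (rule filterlim_compose[OF bot ln_at_0])
  moreover have "(?w \<longlongrightarrow> 0) at_top"
    by (rule filterlim_compose[OF exp_at_bot], subst filterlim_uminus_at_bot, simp)
       (rule filterlim_compose[OF top ln_at_top])
  ultimately show ?thesis by (simp add: strictly_monotone_weight_def)
qed

end

section \<open>Norms of step functions\<close>

text \<open>The test functions. As a maximum of multiples of indicators of \<open>(-\<infinity>, p k]\<close>, they are bounded above by
  the sum of these multiples, and below by the single multiples on disjoint pieces when the points
  \<open>p k\<close> are separated. So the heights \<open>a k\<close> need not be ordered.\<close>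

definition step :: "nat set \<Rightarrow> (nat \<Rightarrow> real) \<Rightarrow> (nat \<Rightarrow> real) \<Rightarrow> real \<Rightarrow> real" where
  "step I a p x = Max (insert 0 (a ` {k \<in> I. x \<le> p k}))"

lemma ennreal_pow_ennreal: "0 \<le> s \<Longrightarrow> ennreal_pow (ennreal s) r = ennreal (s powr r)"
  by (simp add: ennreal_pow_def)

lemma ennreal_pow_mono:
  assumes "0 \<le> r" "x \<le> y"
  shows "ennreal_pow x r \<le> ennreal_pow y r"
proof (cases "y = \<infinity>")
  case False
  then have "x \<noteq> \<infinity>" using assms(2) by (auto simp: top_unique)
  moreover have "enn2real x \<le> enn2real y" using assms(2) False by (intro enn2real_mono) (auto simp: less_top)
  ultimately show ?thesis
    using False assms(1) by (simp add: ennreal_pow_def ennreal_leI powr_mono2)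
qed (simp add: ennreal_pow_def)

lemma sum_indicator_disjoint_le:
  fixes c :: "nat \<Rightarrow> ennreal"
  assumes "finite I" "\<And>i j. i \<in> I \<Longrightarrow> j \<in> I \<Longrightarrow> i \<noteq> j \<Longrightarrow> S i \<inter> S j = {}"
    and "\<And>i. i \<in> I \<Longrightarrow> x \<in> S i \<Longrightarrow> c i \<le> s"
  shows "(\<Sum>i\<in>I. c i * indicator (S i) x) \<le> s"
proof (cases "\<exists>k\<in>I. x \<in> S k")
  case True
  then obtain k where k: "k \<in> I" "x \<in> S k" by blast
  then have "x \<notin> S i" if "i \<in> I - {k}" for i using assms(2)[of i k] that by auto
  then have "(\<Sum>i\<in>I - {k}. c i * indicator (S i) x) = 0" by (intro sum.neutral) auto
  then have "(\<Sum>i\<in>I. c i * indicator (S i) x) = c k"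
    using k assms(1) by (simp add: sum.remove)
  with assms(3)[OF k] show ?thesis by simp
next
  case False
  then have "(\<Sum>i\<in>I. c i * indicator (S i) x) = 0" by (intro sum.neutral) auto
  then show ?thesis by simp
qed

section \<open>Rearrangement and Orlicz integral of step functions\<close>

definition step_data :: "nat set \<Rightarrow> (nat \<Rightarrow> real) \<Rightarrow> (nat \<Rightarrow> real) \<Rightarrow> bool" where
  "step_data I a p \<longleftrightarrow> finite I \<and> (\<forall>k\<in>I. 0 < a k \<and> 0 < p k)"

lemma step_finite: "step_data I a p \<Longrightarrow> finite I"
  and step_height_pos: "step_data I a p \<Longrightarrow> k \<in> I \<Longrightarrow> 0 < a k"
  and step_point_pos: "step_data I a p \<Longrightarrow> k \<in> I \<Longrightarrow> 0 < p k"
  by (auto simp: step_data_def)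

context
  fixes I :: "nat set" and a p :: "nat \<Rightarrow> real"
  assumes D: "step_data I a p"
begin

lemma step_nonneg: "0 \<le> step I a p x"
  unfolding step_def using step_finite[OF D] by (intro Max_ge) auto

lemma step_ge: "k \<in> I \<Longrightarrow> x \<le> p k \<Longrightarrow> a k \<le> step I a p x"
  unfolding step_def using step_finite[OF D] by (intro Max_ge) auto

lemma step_cases:
  obtains "step I a p x = 0" | k where "k \<in> I" "x \<le> p k" "step I a p x = a k"
proof -
  have "step I a p x \<in> insert 0 (a ` {k \<in> I. x \<le> p k})"
    unfolding step_def using step_finite[OF D] by (intro Max_in) auto
  then show ?thesis using that by auto
qed

lemma step_antimono: "x \<le> y \<Longrightarrow> step I a p y \<le> step I a p x"
  unfolding step_def using step_finite[OF D] by (intro Max_mono) auto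

lemma step_measurable: "step I a p \<in> borel_measurable borel"
proof -
  have "(\<lambda>x. - step I a p x) \<in> borel_measurable borel"
    by (rule borel_measurable_mono) (simp add: mono_def step_antimono)
  from borel_measurable_uminus[OF this] show ?thesis by simp
qed

lemma step_measurable_lebesgue_on: "(\<lambda>x. complex_of_real (step I a p x)) \<in> borel_measurable (lebesgue_on S)"
proof -
  have "step I a p \<in> borel_measurable lebesgue"
    using step_measurable by (intro measurable_completion) simp
  from measurable_compose[OF measurable_restrict_space1[OF this] borel_measurable_of_real]
  show ?thesis .
qed

text \<open>A nonnegative, non-increasing, left-continuous function is its own rearrangement. The
  condition \<open>x \<le> p k\<close> in \<open>step\<close> provides the left continuity that
  matches the non-strict inequalities in \<open>rearrangement\<close>, so the equality holds at the
  jumps too.\<close>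

lemma rearrangement_step:
  assumes "0 < x"
  shows "rearrangement (lebesgue_on {0..}) (\<lambda>y. complex_of_real (step I a p y)) x = ennreal (step I a p x)"
proof -
  let ?f = "\<lambda>y. complex_of_real (step I a p y)"
  have cm: "cmod (?f y) = step I a p y" for y using step_nonneg by simp
  have meas: "{y. 0 \<le> y \<and> t \<le> step I a p y} \<in> sets lebesgue" for t
  proof -
    have "{y \<in> space borel. 0 \<le> y \<and> t \<le> step I a p y} \<in> sets borel"
      using step_measurable by measurable
    then show ?thesis by auto
  qed
  have em: "emeasure (lebesgue_on {0..}) {y \<in> space (lebesgue_on {0..}). t \<le> cmod (?f y)}
      = emeasure lebesgue {y. 0 \<le> y \<and> t \<le> step I a p y}" for t
    unfolding cm by (subst emeasure_restrict_space) (auto intro!: arg_cong[where f = "emeasure lebesgue"])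
  have "t \<le> step I a p x"
    if "0 \<le> t" and le: "ennreal x \<le> emeasure lebesgue {y. 0 \<le> y \<and> t \<le> step I a p y}" for t
  proof (rule ccontr)
    assume "\<not> ?thesis"
    then have t: "step I a p x < t" by simp
    \<comment> \<open>The right end of the superlevel set at height \<open>t\<close>; every
      \<open>p k\<close> with \<open>t \<le> a k\<close> lies below \<open>x\<close>, since
      otherwise the step function at \<open>x\<close> would reach \<open>t\<close>.\<close>
    define m where "m = Max (insert 0 (p ` {k \<in> I. t \<le> a k}))"
    have m0: "0 \<le> m" using step_finite[OF D] by (simp add: m_def)
    have "p k < x" if "k \<in> I" "t \<le> a k" for k
      using step_ge[OF that(1), of x] that t by (cases "x \<le> p k") auto
    then have "m < x" using step_finite[OF D] assms by (simp add: m_def)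
    have "{y. 0 \<le> y \<and> t \<le> step I a p y} \<subseteq> {0..m}"
    proof
      fix y assume y: "y \<in> {y. 0 \<le> y \<and> t \<le> step I a p y}"
      have "0 < t" using t step_nonneg[of x] by simp
      with y obtain k where k: "k \<in> I" "y \<le> p k" "t \<le> a k"
        by (cases rule: step_cases[of y]) auto
      then have "p k \<le> m" unfolding m_def using step_finite[OF D] by (intro Max_ge) auto
      with k y show "y \<in> {0..m}" by simp
    qed
    then have "emeasure lebesgue {y. 0 \<le> y \<and> t \<le> step I a p y} \<le> emeasure lebesgue {0..m}"
      by (rule emeasure_mono) auto
    also have "\<dots> = ennreal m" using m0 by simp
    finally have "ennreal x \<le> ennreal m" using le by simp
    then show False using \<open>m < x\<close> m0 by simp
  qed
  moreover have "ennreal x \<le> emeasure lebesgue {y. 0 \<le> y \<and> step I a p x \<le> step I a p y}"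
  proof -
    have "ennreal x = emeasure lebesgue {0..x}" using assms by simp
    also have "\<dots> \<le> emeasure lebesgue {y. 0 \<le> y \<and> step I a p x \<le> step I a p y}"
      by (rule emeasure_mono[OF _ meas]) (auto intro: step_antimono)
    finally show ?thesis .
  qed
  ultimately show ?thesis
    unfolding rearrangement_def em using step_nonneg
    by (intro antisym Sup_least Sup_upper) (auto intro!: ennreal_leI)
qed

lemma orlicz_integral_step_le:
  assumes F: "phi_function F" and "0 < c"
  shows "(\<integral>\<^sup>+ y. ennreal (F (cmod (complex_of_real (step I a p y)) / c)) \<partial>lebesgue_on {0..})
      \<le> ennreal (\<Sum>k\<in>I. F (a k / c) * p k)"
proof -
  have Fa: "0 \<le> F (a k / c)" if "k \<in> I" for k
    using phi_function_nonneg[OF F] step_height_pos[OF D that] assms(2) by simp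
  have "ennreal (F (cmod (complex_of_real (step I a p y)) / c)) * indicator {0..} y
      \<le> (\<Sum>k\<in>I. ennreal (F (a k / c)) * indicator {0..p k} y)" for y
  proof (cases rule: step_cases[of y])
    case 1
    then show ?thesis using phi_function_zero[OF F] by simp
  next
    case (2 k)
    have "ennreal (F (cmod (complex_of_real (step I a p y)) / c)) * indicator {0..} y
        \<le> ennreal (F (a k / c)) * indicator {0..p k} y"
      using 2 step_height_pos[OF D 2(1)] by (auto split: split_indicator)
    also have "\<dots> \<le> (\<Sum>k\<in>I. ennreal (F (a k / c)) * indicator {0..p k} y)"
      using step_finite[OF D] 2(1) by (intro member_le_sum) auto
    finally show ?thesis .
  qed
  then have "(\<integral>\<^sup>+ y. ennreal (F (cmod (complex_of_real (step I a p y)) / c)) \<partial>lebesgue_on {0..})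
      \<le> (\<integral>\<^sup>+ y. (\<Sum>k\<in>I. ennreal (F (a k / c)) * indicator {0..p k} y) \<partial>lebesgue)"
    by (subst nn_integral_restrict_space) (auto intro!: nn_integral_mono)
  also have "\<dots> = (\<Sum>k\<in>I. \<integral>\<^sup>+ y. ennreal (F (a k / c)) * indicator {0..p k} y \<partial>lebesgue)"
    by (intro nn_integral_sum borel_measurable_times_ennreal borel_measurable_indicator) auto
  also have "\<dots> = (\<Sum>k\<in>I. ennreal (F (a k / c) * p k))"
    using Fa step_point_pos[OF D] by (intro sum.cong refl, subst nn_integral_cmult_indicator)
      (auto simp: ennreal_mult' less_imp_le)
  also have "\<dots> = ennreal (\<Sum>k\<in>I. F (a k / c) * p k)"
    using Fa step_point_pos[OF D] by (intro sum_ennreal) (auto simp: less_imp_le)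
  finally show ?thesis .
qed

text \<open>By separation the intervals \<open>{p k / 2<..p k}\<close> are disjoint; keeping half of
  each length costs the factor 1/2.\<close>

lemma orlicz_integral_step_ge:
  assumes F: "phi_function F" and "0 < c"
    and sep: "\<And>i j. i \<in> I \<Longrightarrow> j \<in> I \<Longrightarrow> i \<noteq> j \<Longrightarrow> 2 * p i \<le> p j \<or> 2 * p j \<le> p i"
  shows "ennreal (\<Sum>k\<in>I. F (a k / c) * p k / 2)
      \<le> (\<integral>\<^sup>+ y. ennreal (F (cmod (complex_of_real (step I a p y)) / c)) \<partial>lebesgue_on {0..})"
proof -
  have Fa: "0 \<le> F (a k / c)" if "k \<in> I" for k
    using phi_function_nonneg[OF F] step_height_pos[OF D that] assms(2) by simp
  have "ennreal (\<Sum>k\<in>I. F (a k / c) * p k / 2) = (\<Sum>k\<in>I. ennreal (F (a k / c) * p k / 2))"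
    using Fa step_point_pos[OF D] by (intro sum_ennreal[symmetric]) (auto simp: less_imp_le)
  also have "\<dots> = (\<Sum>k\<in>I. \<integral>\<^sup>+ y. ennreal (F (a k / c)) * indicator {p k / 2<..p k} y \<partial>lebesgue)"
    using Fa step_point_pos[OF D] by (intro sum.cong refl, subst nn_integral_cmult_indicator)
      (auto simp: less_imp_le simp flip: ennreal_mult')
  also have "\<dots> = (\<integral>\<^sup>+ y. (\<Sum>k\<in>I. ennreal (F (a k / c)) * indicator {p k / 2<..p k} y) \<partial>lebesgue)"
    by (intro nn_integral_sum[symmetric] borel_measurable_times_ennreal borel_measurable_indicator) auto
  also have "\<dots> \<le> (\<integral>\<^sup>+ y. ennreal (F (cmod (complex_of_real (step I a p y)) / c)) * indicator {0..} y \<partial>lebesgue)"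
  proof (intro nn_integral_mono sum_indicator_disjoint_le step_finite[OF D])
    fix i j assume "i \<in> I" "j \<in> I" "i \<noteq> j"
    then show "{p i / 2<..p i} \<inter> {p j / 2<..p j} = {}" using sep[of i j] by force
  next
    fix k y assume k: "k \<in> I" and y: "y \<in> {p k / 2<..p k}"
    have "a k / c \<le> step I a p y / c"
      using y step_ge[OF k, of y] assms(2) by (simp add: divide_right_mono)
    then have "F (a k / c) \<le> F (step I a p y / c)"
      using step_height_pos[OF D k] assms(2) by (intro phi_function_mono[OF F]) auto
    moreover have "0 \<le> y" using step_point_pos[OF D k] y by simp
    ultimately show "ennreal (F (a k / c))
        \<le> ennreal (F (cmod (complex_of_real (step I a p y)) / c)) * indicator {0..} y"
      using step_nonneg by (simp add: ennreal_leI)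
  qed
  also have "\<dots> = (\<integral>\<^sup>+ y. ennreal (F (cmod (complex_of_real (step I a p y)) / c)) \<partial>lebesgue_on {0..})"
    by (subst nn_integral_restrict_space) auto
  finally show ?thesis .
qed

end

section \<open>Integrals of the weight and Lorentz functionals of step functions\<close>

lemma weight_function_pos: "weight_function w \<Longrightarrow> 0 < x \<Longrightarrow> 0 < w x"
  by (auto simp: weight_function_def)

lemma weight_function_phi: "weight_function w \<Longrightarrow> phi_function (weight_integral w)"
  by (simp add: weight_function_def)

lemma weight_measurable:
  assumes "weight_function w" "0 \<le> u" "u < t"
  shows "(\<lambda>x. ennreal (w x) * indicator {u<..t} x) \<in> borel_measurable lebesgue"
proof -
  have "set_integrable lebesgue {u<..t} w"
    using assms by (intro set_integrable_subset[where A = "{0<..t}" and B = "{u<..t}"])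
      (auto simp: weight_function_def)
  then have "(\<lambda>x. ennreal (indicator {u<..t} x *\<^sub>R w x)) \<in> borel_measurable lebesgue"
    unfolding set_integrable_def by auto
  then show ?thesis
    by (rule measurable_cong[THEN iffD1, rotated]) (auto split: split_indicator)
qed

lemma weight_nn_integral_0:
  assumes w: "weight_function w" and "0 < t"
  shows "(\<integral>\<^sup>+ x. ennreal (w x) * indicator {0<..t} x \<partial>lebesgue) = ennreal (weight_integral w t)"
proof -
  have int: "integrable lebesgue (\<lambda>x. indicator {0<..t} x *\<^sub>R w x)"
    using assms by (simp add: weight_function_def set_integrable_def)
  have "(\<integral>\<^sup>+ x. ennreal (w x) * indicator {0<..t} x \<partial>lebesgue)
      = (\<integral>\<^sup>+ x. ennreal (indicator {0<..t} x *\<^sub>R w x) \<partial>lebesgue)"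
    by (intro nn_integral_cong) (auto split: split_indicator)
  also have "\<dots> = ennreal (weight_integral w t)"
    unfolding weight_integral_def set_lebesgue_integral_def
    using weight_function_pos[OF w]
    by (intro nn_integral_eq_integral int) (auto split: split_indicator simp: less_imp_le)
  finally show ?thesis .
qed

lemma weight_nn_integral:
  assumes w: "weight_function w" and "0 < u" "u < t"
  shows "(\<integral>\<^sup>+ x. ennreal (w x) * indicator {u<..t} x \<partial>lebesgue)
      = ennreal (weight_integral w t - weight_integral w u)"
proof -
  have "ennreal (weight_integral w t) = (\<integral>\<^sup>+ x. ennreal (w x) * indicator {0<..t} x \<partial>lebesgue)"
    using assms by (simp add: weight_nn_integral_0)
  also have "\<dots> = (\<integral>\<^sup>+ x. ennreal (w x) * indicator {0<..u} x + ennreal (w x) * indicator {u<..t} x \<partial>lebesgue)"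
    using assms by (intro nn_integral_cong) (auto split: split_indicator)
  also have "\<dots> = ennreal (weight_integral w u) + (\<integral>\<^sup>+ x. ennreal (w x) * indicator {u<..t} x \<partial>lebesgue)"
    using assms by (subst nn_integral_add) (auto simp: weight_measurable weight_nn_integral_0)
  finally have "(\<integral>\<^sup>+ x. ennreal (w x) * indicator {u<..t} x \<partial>lebesgue)
      = ennreal (weight_integral w t) - ennreal (weight_integral w u)"
    by simp
  then show ?thesis
    using phi_function_nonneg[OF weight_function_phi[OF w], of u] assms by (simp add: ennreal_minus)
qed

context
  fixes I :: "nat set" and a p :: "nat \<Rightarrow> real" and w :: "real \<Rightarrow> real" and r :: real
  assumes D: "step_data I a p" and w: "weight_function w" and r: "0 < r"
begin

lemma lorentz_step_eq:
  "lorentz (lebesgue_on {0..}) w r (\<lambda>y. complex_of_real (step I a p y))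
   = ennreal_pow (\<integral>\<^sup>+ x. ennreal (w x) * ennreal (step I a p x powr r) * indicator {0<..} x \<partial>lebesgue) (1 / r)"
proof -
  have "(\<integral>\<^sup>+ x. ennreal (w x) * ennreal_pow (rearrangement (lebesgue_on {0..}) (\<lambda>y. complex_of_real (step I a p y)) x) r
          \<partial>lebesgue_on {0<..})
      = (\<integral>\<^sup>+ x. ennreal (w x) * ennreal (step I a p x powr r) \<partial>lebesgue_on {0<..})"
    using step_nonneg[OF D] rearrangement_step[OF D]
    by (intro nn_integral_cong) (simp add: ennreal_pow_ennreal)
  then show ?thesis
    by (simp add: lorentz_def nn_integral_restrict_space)
qed

lemma lorentz_step_le:
  "lorentz (lebesgue_on {0..}) w r (\<lambda>y. complex_of_real (step I a p y))
    \<le> ennreal ((\<Sum>k\<in>I. a k powr r * weight_integral w (p k)) powr (1 / r))"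
proof -
  have W0: "0 \<le> weight_integral w (p k)" if "k \<in> I" for k
    using phi_function_nonneg[OF weight_function_phi[OF w]] step_point_pos[OF D that] by simp
  have "ennreal (w x) * ennreal (step I a p x powr r) * indicator {0<..} x
      \<le> (\<Sum>k\<in>I. ennreal (a k powr r) * (ennreal (w x) * indicator {0<..p k} x))" for x
  proof (cases rule: step_cases[OF D, of x])
    case 1
    then show ?thesis using r by simp
  next
    case (2 k)
    have "ennreal (w x) * ennreal (step I a p x powr r) * indicator {0<..} x
        \<le> ennreal (a k powr r) * (ennreal (w x) * indicator {0<..p k} x)"
      using 2 by (auto split: split_indicator simp: mult.commute)
    also have "\<dots> \<le> (\<Sum>k\<in>I. ennreal (a k powr r) * (ennreal (w x) * indicator {0<..p k} x))"
      using step_finite[OF D] 2(1)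
      by (intro member_le_sum[where
            f = "\<lambda>k. ennreal (a k powr r) * (ennreal (w x) * indicator {0<..p k} x)"]) auto
    finally show ?thesis .
  qed
  then have "(\<integral>\<^sup>+ x. ennreal (w x) * ennreal (step I a p x powr r) * indicator {0<..} x \<partial>lebesgue)
      \<le> (\<integral>\<^sup>+ x. (\<Sum>k\<in>I. ennreal (a k powr r) * (ennreal (w x) * indicator {0<..p k} x)) \<partial>lebesgue)"
    by (intro nn_integral_mono)
  also have "\<dots> = (\<Sum>k\<in>I. \<integral>\<^sup>+ x. ennreal (a k powr r) * (ennreal (w x) * indicator {0<..p k} x) \<partial>lebesgue)"
    using step_point_pos[OF D] w by (intro nn_integral_sum borel_measurable_times_ennreal weight_measurable) auto
  also have "\<dots> = (\<Sum>k\<in>I. ennreal (a k powr r * weight_integral w (p k)))"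
    using step_point_pos[OF D] w W0 by (intro sum.cong refl, subst nn_integral_cmult)
      (auto simp: weight_measurable weight_nn_integral_0 ennreal_mult')
  also have "\<dots> = ennreal (\<Sum>k\<in>I. a k powr r * weight_integral w (p k))"
    using W0 by (intro sum_ennreal) auto
  finally have "(\<integral>\<^sup>+ x. ennreal (w x) * ennreal (step I a p x powr r) * indicator {0<..} x \<partial>lebesgue)
      \<le> ennreal (\<Sum>k\<in>I. a k powr r * weight_integral w (p k))" .
  from ennreal_pow_mono[OF _ this, of "1 / r"] show ?thesis
    unfolding lorentz_step_eq using W0 r by (simp add: ennreal_pow_ennreal sum_nonneg)
qed

text \<open>Here separation is measured by \<open>W\<close>: the point \<open>u k\<close> halves
  \<open>W (p k)\<close>, and the intervals \<open>{u k<..p k}\<close> are disjoint because the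
  values \<open>W (p k)\<close> differ at least by the factor 2.\<close>

lemma lorentz_step_ge:
  assumes sep: "\<And>i j. i \<in> I \<Longrightarrow> j \<in> I \<Longrightarrow> i \<noteq> j \<Longrightarrow>
      2 * weight_integral w (p i) \<le> weight_integral w (p j) \<or> 2 * weight_integral w (p j) \<le> weight_integral w (p i)"
  shows "ennreal ((\<Sum>k\<in>I. a k powr r * weight_integral w (p k) / 2) powr (1 / r))
    \<le> lorentz (lebesgue_on {0..}) w r (\<lambda>y. complex_of_real (step I a p y))"
proof -
  note W = weight_function_phi[OF w]
  have W0: "0 < weight_integral w (p k)" if "k \<in> I" for k
    using phi_function_pos[OF W] step_point_pos[OF D that] by simp
  have "\<exists>u. 0 < u \<and> 2 * weight_integral w u = weight_integral w (p k)" if "k \<in> I" for k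
    using phi_function_surj[OF W, of "weight_integral w (p k) / 2"] W0[OF that]
    by (metis half_gt_zero nonzero_mult_div_cancel_left times_divide_eq_right zero_neq_numeral)
  then obtain u where u: "\<And>k. k \<in> I \<Longrightarrow> 0 < u k"
    "\<And>k. k \<in> I \<Longrightarrow> 2 * weight_integral w (u k) = weight_integral w (p k)"
    by metis
  have up: "u k < p k" if "k \<in> I" for k
    using phi_function_le_cancel[OF W step_point_pos[OF D that] u(1)[OF that]] u(2)[OF that] W0[OF that]
    by (cases "p k \<le> u k") (use phi_function_mono[OF W, of "p k" "u k"] step_point_pos[OF D that] in auto)
  have half: "weight_integral w (p k) - weight_integral w (u k) = weight_integral w (p k) / 2" if "k \<in> I" for k
    using u(2)[OF that] by simp
  have "ennreal (\<Sum>k\<in>I. a k powr r * weight_integral w (p k) / 2)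
      = (\<Sum>k\<in>I. ennreal (a k powr r * weight_integral w (p k) / 2))"
    using W0 by (intro sum_ennreal[symmetric]) (auto simp: less_imp_le)
  also have "\<dots> = (\<Sum>k\<in>I. \<integral>\<^sup>+ x. ennreal (a k powr r) * (ennreal (w x) * indicator {u k<..p k} x) \<partial>lebesgue)"
    using u(1) up w W0
    by (intro sum.cong refl, subst nn_integral_cmult)
       (auto simp: weight_measurable weight_nn_integral less_imp_le half simp flip: ennreal_mult')
  also have "\<dots> = (\<integral>\<^sup>+ x. (\<Sum>k\<in>I. ennreal (a k powr r) * (ennreal (w x) * indicator {u k<..p k} x)) \<partial>lebesgue)"
    using u(1) up w
    by (intro nn_integral_sum[symmetric] borel_measurable_times_ennreal weight_measurable) (auto simp: less_imp_le)
  also have "\<dots> \<le> (\<integral>\<^sup>+ x. ennreal (w x) * ennreal (step I a p x powr r) * indicator {0<..} x \<partial>lebesgue)"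
    unfolding mult.assoc[symmetric]
  proof (intro nn_integral_mono sum_indicator_disjoint_le step_finite[OF D])
    fix i j assume ij: "i \<in> I" "j \<in> I" "i \<noteq> j"
    from sep[OF ij] have "weight_integral w (p j) \<le> weight_integral w (u i) \<or>
        weight_integral w (p i) \<le> weight_integral w (u j)"
      using u(2)[OF ij(1)] u(2)[OF ij(2)] by auto
    then have "p j \<le> u i \<or> p i \<le> u j"
      using phi_function_le_cancel[OF W] u(1) step_point_pos[OF D] ij by blast
    then show "{u i<..p i} \<inter> {u j<..p j} = {}" by auto
  next
    fix k x assume k: "k \<in> I" and x: "x \<in> {u k<..p k}"
    have "a k powr r \<le> step I a p x powr r"
      using step_height_pos[OF D k] r x step_ge[OF D k, of x] by (intro powr_mono2) auto
    then have "ennreal (a k powr r) * ennreal (w x) \<le> ennreal (step I a p x powr r) * ennreal (w x)"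
      by (intro mult_right_mono ennreal_leI) auto
    then show "ennreal (a k powr r) * ennreal (w x)
        \<le> ennreal (w x) * ennreal (step I a p x powr r) * indicator {0<..} x"
      using u(1)[OF k] x by (simp add: mult.commute)
  qed
  finally have "ennreal (\<Sum>k\<in>I. a k powr r * weight_integral w (p k) / 2)
      \<le> (\<integral>\<^sup>+ x. ennreal (w x) * ennreal (step I a p x powr r) * indicator {0<..} x \<partial>lebesgue)" .
  from ennreal_pow_mono[OF _ this, of "1 / r"] show ?thesis
    unfolding lorentz_step_eq using W0 r by (simp add: ennreal_pow_ennreal sum_nonneg less_imp_le)
qed

end

section \<open>From the equivalence of the norms to the test inequalities\<close>

lemma luxemburg_le:
  assumes "0 < c" "(\<integral>\<^sup>+ y. ennreal (F (cmod (f y) / c)) \<partial>M) \<le> 1"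
  shows "luxemburg M F f \<le> ennreal c"
  unfolding luxemburg_def using assms by (intro Inf_lower CollectI exI[of _ c] conjI refl)

text \<open>Strictness supplies an admissible \<open>d\<close> below \<open>c\<close>, and the
  integral does not increase with the scaling constant.\<close>

lemma luxemburg_less:
  assumes F: "phi_function F" and c: "0 < c" and "luxemburg M F f < ennreal c"
  shows "(\<integral>\<^sup>+ y. ennreal (F (cmod (f y) / c)) \<partial>M) \<le> 1"
proof -
  obtain d where d: "0 < d" "ennreal d < ennreal c" "(\<integral>\<^sup>+ y. ennreal (F (cmod (f y) / d)) \<partial>M) \<le> 1"
    using assms(3) unfolding luxemburg_def Inf_less_iff by auto
  then have "d \<le> c" using c by (simp add: ennreal_less_iff)
  have "(\<integral>\<^sup>+ y. ennreal (F (cmod (f y) / c)) \<partial>M) \<le> (\<integral>\<^sup>+ y. ennreal (F (cmod (f y) / d)) \<partial>M)"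
    using c d(1) \<open>d \<le> c\<close>
    by (intro nn_integral_mono ennreal_leI phi_function_mono[OF F] divide_left_mono) auto
  with d(3) show ?thesis by simp
qed

locale orlicz_lorentz =
  fixes w F :: "real \<Rightarrow> real" and r c :: real
  assumes w: "weight_function w" and F: "phi_function F" and r: "0 < r" and c: "0 < c"
    and lux_le: "\<And>f :: real \<Rightarrow> complex. f \<in> borel_measurable (lebesgue_on {0..}) \<Longrightarrow>
      luxemburg (lebesgue_on {0..}) F f \<le> ennreal c * lorentz (lebesgue_on {0..}) w r f"
    and lor_le: "\<And>f :: real \<Rightarrow> complex. f \<in> borel_measurable (lebesgue_on {0..}) \<Longrightarrow>
      lorentz (lebesgue_on {0..}) w r f \<le> ennreal c * luxemburg (lebesgue_on {0..}) F f"
begin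

abbreviation W :: "real \<Rightarrow> real" where "W \<equiv> weight_integral w"

text \<open>The power of 2 absorbs the factor 1/2 from \<open>lorentz_step_ge\<close>; the summand 1
  makes the comparisons with \<open>c\<close> strict.\<close>

definition C :: real where "C = c * 2 powr (1 / r) + 1"

lemma W_phi: "phi_function W" using weight_function_phi[OF w] .

lemma W_pos: "0 < x \<Longrightarrow> 0 < W x" using phi_function_pos[OF W_phi] .

lemma C_gt: "c * 2 powr (1 / r) < C" and C_gt_c: "c < C" and C_pos: "0 < C"
proof -
  show *: "c * 2 powr (1 / r) < C" by (simp add: C_def)
  have "c * 1 \<le> c * 2 powr (1 / r)" using c r by (intro mult_left_mono ge_one_powr_ge_zero) auto
  with * show "c < C" by simp
  with c show "0 < C" by simp
qed

text \<open>Both norms of an indicator function are known explicitly; this determines \<open>F\<close> up to a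
  dilation of its argument.\<close>

lemma F_le:
  assumes "0 < h"
  shows "F (1 / (C * W h powr (1 / r))) \<le> 2 / h"
proof -
  define I :: "nat set" where "I = {0}"
  define a :: "nat \<Rightarrow> real" where "a k = 1" for k
  define p :: "nat \<Rightarrow> real" where "p k = h" for k
  let ?f = "\<lambda>y. complex_of_real (step I a p y)"
  have D: "step_data I a p"
    using assms by (auto simp: step_data_def I_def a_def p_def)
  define s where "s = W h powr (1 / r)"
  have s: "0 < s" using W_pos[OF assms] by (simp add: s_def)
  have Cs: "0 < C * s" using C_pos s by simp
  have "lorentz (lebesgue_on {0..}) w r ?f \<le> ennreal s"
    using lorentz_step_le[OF D w r] by (simp add: I_def a_def p_def s_def)
  then have "ennreal c * lorentz (lebesgue_on {0..}) w r ?f \<le> ennreal c * ennreal s"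
    by (rule mult_left_mono) simp
  also have "\<dots> < ennreal (C * s)"
    using c s C_gt_c by (simp flip: ennreal_mult' add: ennreal_less_iff)
  finally have "luxemburg (lebesgue_on {0..}) F ?f < ennreal (C * s)"
    using lux_le[OF step_measurable_lebesgue_on[OF D]] by (rule le_less_trans[rotated])
  from order_trans[OF orlicz_integral_step_ge[OF D F Cs] luxemburg_less[OF F Cs this]]
  have "ennreal (F (1 / (C * s)) * h / 2) \<le> ennreal 1"
    by (simp add: I_def a_def p_def)
  then show ?thesis using assms by (simp add: s_def field_simps)
qed

lemma F_ge:
  assumes "0 < h"
  shows "1 / h \<le> F (C / W h powr (1 / r))"
proof (rule ccontr)
  assume less: "\<not> ?thesis"
  define I :: "nat set" where "I = {0}"
  define a :: "nat \<Rightarrow> real" where "a k = 1" for k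
  define p :: "nat \<Rightarrow> real" where "p k = h" for k
  let ?f = "\<lambda>y. complex_of_real (step I a p y)"
  have D: "step_data I a p"
    using assms by (auto simp: step_data_def I_def a_def p_def)
  define s where "s = W h powr (1 / r)"
  have s: "0 < s" using W_pos[OF assms] by (simp add: s_def)
  have sC: "0 < s / C" using C_pos s by simp
  \<comment> \<open>If the claim failed, \<open>s / C\<close> would be admissible for the Luxemburg
    norm of the indicator. The Lorentz norm would then be at most \<open>c * s / C\<close>, less
    than its lower bound \<open>s / 2 powr (1 / r)\<close>.\<close>
  have "F (1 / (s / C)) * h \<le> 1"
    using less assms by (simp add: s_def field_simps)
  then have "ennreal (\<Sum>k\<in>I. F (a k / (s / C)) * p k) \<le> 1"
    by (simp add: I_def a_def p_def)
  from luxemburg_le[OF sC order_trans[OF orlicz_integral_step_le[OF D F sC] this]]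
  have "luxemburg (lebesgue_on {0..}) F ?f \<le> ennreal (s / C)" .
  then have "ennreal c * luxemburg (lebesgue_on {0..}) F ?f \<le> ennreal c * ennreal (s / C)"
    by (rule mult_left_mono) simp
  from order_trans[OF lor_le[OF step_measurable_lebesgue_on[OF D]] this]
  have "lorentz (lebesgue_on {0..}) w r ?f \<le> ennreal (c * (s / C))"
    using c by (simp add: ennreal_mult' del: times_divide_eq_right)
  moreover have "ennreal ((W h / 2) powr (1 / r)) \<le> lorentz (lebesgue_on {0..}) w r ?f"
    using lorentz_step_ge[OF D w r] by (simp add: I_def a_def p_def)
  ultimately have "(W h / 2) powr (1 / r) \<le> c * (s / C)"
    using c sC ennreal_le_iff[of "c * (s / C)" "(W h / 2) powr (1 / r)"]
    by (meson less_imp_le mult_nonneg_nonneg order_trans)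
  then have "s / 2 powr (1 / r) \<le> c * (s / C)"
    using W_pos[OF assms] by (simp add: powr_divide s_def)
  then show False using s C_gt C_pos by (simp add: field_simps)
qed

text \<open>One constant for both test inequalities: 2 bounds the sum of the
  \<open>p i / q i\<close> and absorbs the factor in \<open>F_le\<close>; the other entry bounds the
  sum for \<open>W\<close> and strictly exceeds \<open>(c * C) powr r\<close>.\<close>

definition B :: real where "B = max 2 (2 * (c * C) powr r + 1)"

text \<open>With heights \<open>W (q k) powr (- 1 / r)\<close> the Lorentz norm is at most
  \<open>S powr (1 / r)\<close>, so the Luxemburg norm falls below \<open>1 / C\<close>. By
  \<open>F_ge\<close> the Orlicz integral at scale \<open>1 / C\<close> is at least half the sum of
  the \<open>p k / q k\<close>.\<close>

lemma test_inequality_ident_W: "test_inequality (\<lambda>x. x) W B"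
  unfolding test_inequality_def
proof (intro allI impI)
  fix I :: "nat set" and p q :: "nat \<Rightarrow> real"
  assume fin: "finite I" and pq: "\<forall>i\<in>I. 0 < p i \<and> 0 < q i"
    and sep: "\<forall>i\<in>I. \<forall>j\<in>I. i \<noteq> j \<longrightarrow> 2 * p i \<le> p j \<or> 2 * p j \<le> p i"
    and le: "B * (\<Sum>i\<in>I. W (p i) / W (q i)) \<le> 1"
  define a where "a k = 1 / W (q k) powr (1 / r)" for k
  define S where "S = (\<Sum>i\<in>I. W (p i) / W (q i))"
  let ?f = "\<lambda>y. complex_of_real (step I a p y)"
  have Wq: "0 < W (q k)" "0 < W (p k)" if "k \<in> I" for k using W_pos pq that by auto
  have D: "step_data I a p"
    using fin pq Wq(1) by (fastforce simp: step_data_def a_def)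
  have ar: "a k powr r = 1 / W (q k)" if "k \<in> I" for k
    using Wq[OF that] r by (simp add: a_def powr_divide powr_powr)
  have S0: "0 \<le> S" unfolding S_def using Wq by (intro sum_nonneg) (auto simp: less_imp_le)
  \<comment> \<open>\<open>S = 0\<close> occurs for empty \<open>I\<close>, where multiplication by
    \<open>S\<close> would not preserve strictness.\<close>
  have "(c * C) powr r * S < 1"
  proof (cases "S = 0")
    case False
    then have "(c * C) powr r * S < B * S"
      using S0 powr_ge_zero[of "c * C" r] by (intro mult_strict_right_mono) (auto simp: B_def)
    with le show ?thesis by (simp add: S_def)
  qed simp
  then have "((c * C) powr r * S) powr (1 / r) < 1 powr (1 / r)"
    using S0 r by (intro powr_less_mono2) auto
  moreover have "((c * C) powr r * S) powr (1 / r) = c * C * S powr (1 / r)"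
    using S0 r c C_pos by (simp add: powr_mult powr_powr)
  ultimately have small: "c * S powr (1 / r) < 1 / C" using C_pos by (simp add: field_simps)
  have "lorentz (lebesgue_on {0..}) w r ?f \<le> ennreal (S powr (1 / r))"
    using lorentz_step_le[OF D w r] by (simp add: S_def ar)
  then have "ennreal c * lorentz (lebesgue_on {0..}) w r ?f \<le> ennreal c * ennreal (S powr (1 / r))"
    by (rule mult_left_mono) simp
  also have "\<dots> < ennreal (1 / C)"
    using c small by (simp flip: ennreal_mult' add: ennreal_less_iff)
  finally have "luxemburg (lebesgue_on {0..}) F ?f < ennreal (1 / C)"
    using lux_le[OF step_measurable_lebesgue_on[OF D]] by (rule le_less_trans[rotated])
  moreover have C1: "0 < 1 / C" using C_pos by simp
  ultimately have "(\<integral>\<^sup>+ y. ennreal (F (cmod (?f y) / (1 / C))) \<partial>lebesgue_on {0..}) \<le> 1"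
    by (intro luxemburg_less[OF F])
  moreover have "ennreal (\<Sum>k\<in>I. F (a k / (1 / C)) * p k / 2)
      \<le> (\<integral>\<^sup>+ y. ennreal (F (cmod (?f y) / (1 / C))) \<partial>lebesgue_on {0..})"
    using sep by (intro orlicz_integral_step_ge[OF D F C1]) blast
  ultimately have "ennreal (\<Sum>k\<in>I. F (a k / (1 / C)) * p k / 2) \<le> 1"
    by (rule order_trans[rotated])
  then have "(\<Sum>k\<in>I. F (a k / (1 / C)) * p k / 2) \<le> 1" by (simp add: ennreal_le_1)
  moreover have "(\<Sum>k\<in>I. p k / q k / 2) \<le> (\<Sum>k\<in>I. F (a k / (1 / C)) * p k / 2)"
  proof (intro sum_mono divide_right_mono)
    fix k assume k: "k \<in> I"
    have "1 / q k * p k \<le> F (C / W (q k) powr (1 / r)) * p k"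
      using F_ge[of "q k"] pq k by (intro mult_right_mono) (simp_all add: less_imp_le)
    then show "p k / q k \<le> F (a k / (1 / C)) * p k" by (simp add: a_def)
  qed auto
  ultimately have "(\<Sum>k\<in>I. p k / q k) / 2 \<le> 1"
    by (simp add: sum_divide_distrib)
  then show "(\<Sum>i\<in>I. p i / q i) \<le> B" by (simp add: B_def)
qed

text \<open>The heights now carry the factor \<open>1 / C\<close>, so that \<open>F_le\<close>
  applies: the Orlicz integral is at most 1, and the resulting bound \<open>c\<close> for the
  Lorentz norm limits the sum of the \<open>W\<close> quotients.\<close>

lemma test_inequality_W_ident: "test_inequality W (\<lambda>x. x) B"
  unfolding test_inequality_def
proof (intro allI impI)
  fix I :: "nat set" and p q :: "nat \<Rightarrow> real"
  assume fin: "finite I" and pq: "\<forall>i\<in>I. 0 < p i \<and> 0 < q i"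
    and sep: "\<forall>i\<in>I. \<forall>j\<in>I. i \<noteq> j \<longrightarrow> 2 * W (p i) \<le> W (p j) \<or> 2 * W (p j) \<le> W (p i)"
    and le: "B * (\<Sum>i\<in>I. p i / q i) \<le> 1"
  define a where "a k = 1 / (C * W (q k) powr (1 / r))" for k
  define S where "S = (\<Sum>i\<in>I. W (p i) / W (q i))"
  let ?f = "\<lambda>y. complex_of_real (step I a p y)"
  have Wq: "0 < W (q k)" "0 < W (p k)" if "k \<in> I" for k using W_pos pq that by auto
  have D: "step_data I a p"
    using fin pq Wq(1) C_pos by (fastforce simp: step_data_def a_def intro!: mult_pos_pos)
  have ar: "a k powr r = 1 / (C powr r * W (q k))" if "k \<in> I" for k
    using Wq[OF that] r C_pos by (simp add: a_def powr_divide powr_powr powr_mult)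
  have S0: "0 \<le> S" unfolding S_def using Wq by (intro sum_nonneg) (auto simp: less_imp_le)
  have "(\<Sum>k\<in>I. F (a k / 1) * p k) \<le> (\<Sum>k\<in>I. 2 * (p k / q k))"
  proof (intro sum_mono)
    fix k assume k: "k \<in> I"
    have "F (a k) * p k \<le> 2 / q k * p k"
      using F_le[of "q k"] pq k by (intro mult_right_mono) (simp_all add: a_def less_imp_le)
    then show "F (a k / 1) * p k \<le> 2 * (p k / q k)" by simp
  qed
  also have "\<dots> = 2 * (\<Sum>k\<in>I. p k / q k)" by (simp add: sum_distrib_left)
  also have "\<dots> \<le> B * (\<Sum>k\<in>I. p k / q k)"
    using pq by (intro mult_right_mono sum_nonneg) (auto simp: B_def less_imp_le)
  also have "\<dots> \<le> 1" by (rule le)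
  finally have "ennreal (\<Sum>k\<in>I. F (a k / 1) * p k) \<le> 1" by simp
  from luxemburg_le[OF _ order_trans[OF orlicz_integral_step_le[OF D F] this]]
  have "luxemburg (lebesgue_on {0..}) F ?f \<le> ennreal 1" by simp
  then have "ennreal c * luxemburg (lebesgue_on {0..}) F ?f \<le> ennreal c * ennreal 1"
    by (rule mult_left_mono) simp
  from order_trans[OF lor_le[OF step_measurable_lebesgue_on[OF D]] this]
  have "lorentz (lebesgue_on {0..}) w r ?f \<le> ennreal c" by simp
  moreover have "ennreal ((\<Sum>k\<in>I. a k powr r * W (p k) / 2) powr (1 / r)) \<le> lorentz (lebesgue_on {0..}) w r ?f"
    using sep by (intro lorentz_step_ge[OF D w r]) auto
  moreover have "(\<Sum>k\<in>I. a k powr r * W (p k) / 2) = S / (2 * C powr r)"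
    unfolding S_def sum_divide_distrib by (intro sum.cong refl) (simp add: ar)
  ultimately have "ennreal ((S / (2 * C powr r)) powr (1 / r)) \<le> ennreal c" by simp
  then have "(S / (2 * C powr r)) powr (1 / r) \<le> c" using c by simp
  then have "((S / (2 * C powr r)) powr (1 / r)) powr r \<le> c powr r"
    using r by (intro powr_mono2) auto
  then have "S / (2 * C powr r) \<le> c powr r"
    using r S0 by (simp add: powr_powr)
  then have "S \<le> 2 * (c * C) powr r"
    using C_pos c by (simp add: powr_mult field_simps)
  then show "(\<Sum>i\<in>I. W (p i) / W (q i)) \<le> B" by (simp add: S_def B_def)
qed

end

section \<open>The decomposition\<close>

text \<open>The minorant contributes continuity and monotonicity but may be constant or bounded;
  \<open>arsinh\<close> adds strict monotonicity and the limits at both ends and is itself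
  slow.\<close>

lemma slow_bijection_minorant:
  assumes c: "0 \<le> c" and L: "0 \<le> L" and step: "\<And>j. f (j + 1) - f j \<le> L"
    and up: "\<And>I p q. ordered_intervals I p q \<Longrightarrow> (\<And>i. i \<in> I \<Longrightarrow> 2 * c < f (q i) - f (p i)) \<Longrightarrow>
        (\<Sum>i\<in>I. exp (of_int (p i) - of_int (q i))) \<le> B"
  shows "slow_bijection (\<lambda>x. lipschitz_minorant L (bi_up c f) x + arsinh x)
    (8 * c + L + 1 + ln 2) (exp 1 * B + 128 / 3)"
proof
  let ?E = "lipschitz_minorant L (bi_up c f)"
  have bi_step: "bi_up c f (j + 1) - bi_up c f j \<le> L" for j
    using bi_up_step[of c L f j] c L step by blast
  have mono: "x \<le> y \<Longrightarrow> ?E x \<le> ?E y" for x y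
    using L bi_up_mono bi_step by (rule lipschitz_minorant_mono)
  show "0 < 8 * c + L + 1 + ln 2"
    using c L ln_gt_zero[of "2::real"] by linarith
  show "slow (8 * c + L + 1 + ln 2) (exp 1 * B + 128 / 3) (\<lambda>x. ?E x + arsinh x)"
    using slow_lipschitz_minorant[of c L f, OF c L step up] slow_arsinh by (rule slow_add)
  show "continuous_on UNIV (\<lambda>x. ?E x + arsinh x)"
    using L bi_up_mono bi_step
    by (intro continuous_intros continuous_on_lipschitz_minorant)
  show "strict_mono (\<lambda>x. ?E x + arsinh x)"
    by (rule strict_monoI) (auto intro!: add_le_less_mono mono)
  show "filterlim (\<lambda>x. ?E x + arsinh x) at_top at_top"
  proof (rule filterlim_at_top_mono)
    show "filterlim (\<lambda>x. ?E 0 + arsinh x) at_top at_top"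
      by (rule filterlim_tendsto_add_at_top[OF tendsto_const arsinh_real_at_top])
    show "\<forall>\<^sub>F x in at_top. ?E 0 + arsinh x \<le> ?E x + arsinh x"
      using eventually_ge_at_top[of 0] by eventually_elim (simp add: mono)
  qed
  show "filterlim (\<lambda>x. ?E x + arsinh x) at_bot at_bot"
  proof (rule filterlim_at_bot_mono)
    show "filterlim (\<lambda>x. ?E 0 + arsinh x) at_bot at_bot"
      unfolding filterlim_at_bot
    proof
      fix z :: real
      have "\<forall>\<^sub>F x :: real in at_bot. arsinh x \<le> z - ?E 0"
        using arsinh_real_at_bot by (simp add: filterlim_at_bot)
      then show "\<forall>\<^sub>F x in at_bot. ?E 0 + arsinh x \<le> z"
        by eventually_elim simp
    qed
    show "\<forall>\<^sub>F x in at_bot. ?E x + arsinh x \<le> ?E 0 + arsinh x"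
      using eventually_le_at_bot[of 0] by eventually_elim (simp add: mono)
  qed
qed

section \<open>Splitting the logarithm of W(t) / t into two slow parts\<close>

context orlicz_lorentz
begin

definition log_mean :: "int \<Rightarrow> real" where "log_mean j = ln (W (exp (of_int j)) / exp (of_int j))"

lemma B_ge: "1 \<le> B" by (simp add: B_def)

lemma log_mean_diff:
  "log_mean i - log_mean j = ln ((W (exp (of_int i)) / exp (of_int i)) / (W (exp (of_int j)) / exp (of_int j)))"
proof -
  have "0 < W (exp (of_int k)) / exp (of_int k)" for k :: int using W_pos by simp
  then show ?thesis by (simp only: log_mean_def ln_divide_pos)
qed

lemma increments:
  obtains k where "0 \<le> k" and
    "\<And>I p q. ordered_intervals I p q \<Longrightarrow> (\<And>i. i \<in> I \<Longrightarrow> 2 * k < log_mean (q i) - log_mean (p i)) \<Longrightarrow>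
       (\<Sum>i\<in>I. exp (of_int (p i) - of_int (q i))) \<le> B" and
    "\<And>I p q. ordered_intervals I p q \<Longrightarrow> (\<And>i. i \<in> I \<Longrightarrow> 2 * k < - log_mean (q i) - - log_mean (p i)) \<Longrightarrow>
       (\<Sum>i\<in>I. exp (of_int (p i) - of_int (q i))) \<le> B"
proof -
  obtain K where K: "1 < K"
    "\<And>I p q. ordered_intervals I p q \<Longrightarrow> (\<And>i. i \<in> I \<Longrightarrow> 0 < p i) \<Longrightarrow>
       (\<And>i. i \<in> I \<Longrightarrow> K * (W (p i) / W (q i)) \<le> p i / q i) \<Longrightarrow> (\<Sum>i\<in>I. p i / q i) \<le> B"
    using test_inequality_increments[OF phi_function_ident W_phi test_inequality_ident_W B_ge] by blast
  obtain K' where K': "1 < K'"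
    "\<And>I p q. ordered_intervals I p q \<Longrightarrow> (\<And>i. i \<in> I \<Longrightarrow> 0 < p i) \<Longrightarrow>
       (\<And>i. i \<in> I \<Longrightarrow> K' * (p i / q i) \<le> W (p i) / W (q i)) \<Longrightarrow> (\<Sum>i\<in>I. W (p i) / W (q i)) \<le> B"
    using test_inequality_increments[OF W_phi phi_function_ident test_inequality_W_ident B_ge] by blast
  \<comment> \<open>Halved because the hysteresis estimates are stated for rises by more than twice
    their parameter.\<close>
  define m where "m = ln (max K K') / 2"
  have W0: "0 < W (exp x)" for x using W_pos by simp
  have ord: "ordered_intervals I (\<lambda>i. exp (real_of_int (p i))) (\<lambda>i. exp (real_of_int (q i)))"
    if "ordered_intervals I p q" for I p q
    using that by (simp add: ordered_intervals_def)
  have gt: "max K K' < v" if "2 * m < ln v" "0 < v" for v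
  proof -
    have "ln (max K K') < ln v" using that by (simp add: m_def)
    then show ?thesis using K(1) that(2) by simp
  qed
  show ?thesis
  proof (rule that[of m])
    show "0 \<le> m" using K(1) by (simp add: m_def)
  next
    fix I :: "nat set" and p q :: "nat \<Rightarrow> int"
    assume o: "ordered_intervals I p q" and inc: "\<And>i. i \<in> I \<Longrightarrow> 2 * m < log_mean (q i) - log_mean (p i)"
    have "(\<Sum>i\<in>I. exp (real_of_int (p i)) / exp (of_int (q i))) \<le> B"
    proof (rule K(2)[OF ord[OF o]])
      fix i assume i: "i \<in> I"
      let ?P = "exp (real_of_int (p i))" and ?Q = "exp (real_of_int (q i))"
      have "max K K' < (W ?Q / ?Q) / (W ?P / ?P)"
        using inc[OF i] W0 unfolding log_mean_diff by (intro gt) auto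
      then have "K < (W ?Q / ?Q) / (W ?P / ?P)" by simp
      then show "K * (W ?P / W ?Q) \<le> ?P / ?Q"
        using W0[of "of_int (p i)"] W0[of "of_int (q i)"] by (simp add: field_simps)
    qed auto
    then show "(\<Sum>i\<in>I. exp (of_int (p i) - of_int (q i))) \<le> B" by (simp add: exp_diff)
  next
    fix I :: "nat set" and p q :: "nat \<Rightarrow> int"
    assume o: "ordered_intervals I p q" and inc: "\<And>i. i \<in> I \<Longrightarrow> 2 * m < - log_mean (q i) - - log_mean (p i)"
    let ?P = "\<lambda>i. exp (real_of_int (p i))" and ?Q = "\<lambda>i. exp (real_of_int (q i))"
    have *: "K' * (?P i / ?Q i) \<le> W (?P i) / W (?Q i)" if i: "i \<in> I" for i
    proof -
      have "2 * m < log_mean (p i) - log_mean (q i)" using inc[OF i] by simp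
      then have "max K K' < (W (?P i) / ?P i) / (W (?Q i) / ?Q i)"
        using W0 unfolding log_mean_diff by (intro gt) auto
      then have "K' < (W (?P i) / ?P i) / (W (?Q i) / ?Q i)" by simp
      then show ?thesis
        using W0[of "of_int (p i)"] W0[of "of_int (q i)"] by (simp add: field_simps)
    qed
    \<comment> \<open>Where W(t) / t falls, the test inequality controls the quotients of
      \<open>W\<close>; since \<open>K' > 1\<close>, these dominate the quotients of the
      points.\<close>
    have "exp (of_int (p i) - of_int (q i)) \<le> W (?P i) / W (?Q i)" if "i \<in> I" for i
    proof -
      have "1 * (?P i / ?Q i) \<le> K' * (?P i / ?Q i)" using K'(1) by (intro mult_right_mono) auto
      with *[OF that] show ?thesis by (simp add: exp_diff)
    qed
    then have "(\<Sum>i\<in>I. exp (of_int (p i) - of_int (q i))) \<le> (\<Sum>i\<in>I. W (?P i) / W (?Q i))"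
      by (rule sum_mono)
    also have "\<dots> \<le> B" using * by (intro K'(2)[OF ord[OF o]]) auto
    finally show "(\<Sum>i\<in>I. exp (of_int (p i) - of_int (q i))) \<le> B" .
  qed
qed

text \<open>From \<open>s\<close> to at most \<open>exp 1 * s\<close>, that is within two doublings,
  \<open>ln W\<close> rises by an amount between 0 and \<open>ln (D * D)\<close> and
  \<open>ln t\<close> by an amount between 0 and 1; so their difference changes by at most
  \<open>L\<close>.\<close>

lemma log_mean_approx:
  obtains L where "1 \<le> L" "\<And>t. 0 < t \<Longrightarrow> \<bar>ln (W t / t) - log_mean \<lfloor>ln t\<rfloor>\<bar> \<le> L" "\<And>j. \<bar>log_mean (j + 1) - log_mean j\<bar> \<le> L"
proof -
  obtain D where D: "\<And>x z. 0 < x \<Longrightarrow> 0 < z \<Longrightarrow> z \<le> 2 * x \<Longrightarrow> W z \<le> D * W x"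
    using test_inequality_doubling[OF phi_function_ident W_phi test_inequality_ident_W B_ge] by blast
  define L where "L = max 1 (ln (D * D))"
  have "W 1 \<le> D * W 1" using D[of 1 1] by simp
  then have D1: "1 \<le> D" using W_pos[of 1] by simp
  have close: "\<bar>ln (W t / t) - ln (W s / s)\<bar> \<le> L" if "0 < s" "s \<le> t" "t \<le> exp 1 * s" for s t
  proof -
    have "exp 1 * s \<le> 3 * s" using exp_le that(1) by (intro mult_right_mono) auto
    with that have "t \<le> 2 * (2 * s)" by linarith
    then have "W t \<le> D * W (2 * s)" using that by (intro D) auto
    also have "\<dots> \<le> D * (D * W s)" using that D1 by (intro mult_left_mono D) auto
    finally have "ln (W t) \<le> ln (D * D * W s)"
      using that W_pos[of s] W_pos[of t] D1 by (simp add: mult.assoc)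
    also have "\<dots> = ln (D * D) + ln (W s)"
      using D1 W_pos[of s] that by (intro ln_mult_pos) auto
    finally have "ln (W t) \<le> ln (D * D) + ln (W s)" .
    moreover have "ln (W s) \<le> ln (W t)"
      using that W_pos[of s] W_pos[of t] phi_function_mono[OF W_phi, of s t] by simp
    moreover have "ln s \<le> ln t" "ln t \<le> 1 + ln s"
    proof -
      show "ln s \<le> ln t" using that by simp
      have "ln t \<le> ln (exp 1 * s)" using that by simp
      then show "ln t \<le> 1 + ln s" using that by (simp add: ln_mult_pos)
    qed
    moreover have "ln (W t / t) = ln (W t) - ln t" "ln (W s / s) = ln (W s) - ln s"
      using that W_pos[of s] W_pos[of t] by (simp_all add: ln_div)
    ultimately show ?thesis unfolding L_def by linarith
  qed
  show ?thesis
  proof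
    show "1 \<le> L" by (simp add: L_def)
    show "\<bar>ln (W t / t) - log_mean \<lfloor>ln t\<rfloor>\<bar> \<le> L" if "0 < t" for t
      unfolding log_mean_def
    proof (rule close)
      have "exp (of_int \<lfloor>ln t\<rfloor>) \<le> exp (ln t)" "exp (ln t) \<le> exp (1 + of_int \<lfloor>ln t\<rfloor>)"
        unfolding exp_le_cancel_iff by linarith+
      then show "exp (of_int \<lfloor>ln t\<rfloor>) \<le> t" "t \<le> exp 1 * exp (of_int \<lfloor>ln t\<rfloor>)"
        using that by (simp_all add: exp_add)
    qed simp
    show "\<bar>log_mean (j + 1) - log_mean j\<bar> \<le> L" for j
      unfolding log_mean_def by (rule close) (simp_all add: exp_add mult.commute)
  qed
qed

lemma factorization:
  "\<exists>w\<^sub>0 w\<^sub>1. strictly_monotone_weight w\<^sub>0 \<and> condition_L w\<^sub>0 \<and>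
     strictly_monotone_weight w\<^sub>1 \<and> condition_L w\<^sub>1 \<and>
     (\<exists>c>0. \<forall>t>0. 1 / c * (W t / t) \<le> w\<^sub>0 t * w\<^sub>1 t \<and> w\<^sub>0 t * w\<^sub>1 t \<le> c * (W t / t))"
proof -
  obtain k where k: "0 \<le> k"
    "\<And>I p q. ordered_intervals I p q \<Longrightarrow> (\<And>i. i \<in> I \<Longrightarrow> 2 * k < log_mean (q i) - log_mean (p i)) \<Longrightarrow>
       (\<Sum>i\<in>I. exp (of_int (p i) - of_int (q i))) \<le> B"
    "\<And>I p q. ordered_intervals I p q \<Longrightarrow> (\<And>i. i \<in> I \<Longrightarrow> 2 * k < - log_mean (q i) - - log_mean (p i)) \<Longrightarrow>
       (\<Sum>i\<in>I. exp (of_int (p i) - of_int (q i))) \<le> B"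
    using increments by blast
  obtain L where L: "1 \<le> L" "\<And>t. 0 < t \<Longrightarrow> \<bar>ln (W t / t) - log_mean \<lfloor>ln t\<rfloor>\<bar> \<le> L"
    "\<And>j. \<bar>log_mean (j + 1) - log_mean j\<bar> \<le> L"
    using log_mean_approx by blast
  have L0: "0 \<le> L" using L(1) by simp
  define g where "g j = - log_mean j" for j
  have steps: "log_mean (j + 1) - log_mean j \<le> L" "g (j + 1) - g j \<le> L" for j
    using L(3)[of j] by (simp_all add: g_def abs_le_iff)
  define E\<^sub>0 where "E\<^sub>0 = lipschitz_minorant L (bi_up k log_mean)"
  define E\<^sub>1 where "E\<^sub>1 = lipschitz_minorant L (bi_up k g)"
  interpret A\<^sub>0: slow_bijection "\<lambda>x. E\<^sub>0 x + arsinh x" "8 * k + L + 1 + ln 2" "exp 1 * B + 128 / 3"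
    unfolding E\<^sub>0_def using k(1) L0 steps(1) k(2) by (rule slow_bijection_minorant)
  interpret A\<^sub>1: slow_bijection "\<lambda>x. E\<^sub>1 x + arsinh x" "8 * k + L + 1 + ln 2" "exp 1 * B + 128 / 3"
    unfolding E\<^sub>1_def using k(1) L0 steps(2) k(3)[folded g_def] by (rule slow_bijection_minorant)
  let ?w\<^sub>0 = "\<lambda>t. exp (E\<^sub>0 (ln t) + arsinh (ln t))" and ?w\<^sub>1 = "\<lambda>t. exp (- (E\<^sub>1 (ln t) + arsinh (ln t)))"
  \<comment> \<open>One \<open>L\<close> for replacing \<open>t\<close> by a grid point, one for the
    two minorants together, \<open>k\<close> for the hysteresis, and the initial value of
    \<open>log_mean\<close>. The two \<open>arsinh\<close> terms cancel in the product.\<close>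
  define M where "M = 2 * L + k + \<bar>log_mean 0\<bar>"
  have "1 / exp M * (W t / t) \<le> ?w\<^sub>0 t * ?w\<^sub>1 t \<and> ?w\<^sub>0 t * ?w\<^sub>1 t \<le> exp M * (W t / t)" if t: "0 < t" for t
  proof -
    let ?j = "\<lfloor>ln t\<rfloor>"
    have bi: "bi_up k log_mean (j + 1) - bi_up k log_mean j \<le> L" "bi_up k g (j + 1) - bi_up k g j \<le> L" for j
      using bi_up_step[of k L log_mean j] bi_up_step[of k L g j] k(1) L0 steps by blast+
    have "bi_up k log_mean ?j \<le> E\<^sub>0 (ln t)" "E\<^sub>0 (ln t) \<le> bi_up k log_mean ?j + L"
      unfolding E\<^sub>0_def using L0 bi_up_mono bi(1)
      by (auto intro!: lipschitz_minorant_ge lipschitz_minorant_le)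
    moreover have "bi_up k g ?j \<le> E\<^sub>1 (ln t)" "E\<^sub>1 (ln t) \<le> bi_up k g ?j + L"
      unfolding E\<^sub>1_def using L0 bi_up_mono bi(2)
      by (auto intro!: lipschitz_minorant_ge lipschitz_minorant_le)
    moreover have "\<bar>log_mean ?j - log_mean 0 - (bi_up k log_mean ?j - bi_up k g ?j)\<bar> \<le> k"
      using bi_up_decomposition[OF k(1), of log_mean ?j] by (simp add: g_def[abs_def])
    ultimately have "ln (W t / t) - M \<le> E\<^sub>0 (ln t) - E\<^sub>1 (ln t)" "E\<^sub>0 (ln t) - E\<^sub>1 (ln t) \<le> ln (W t / t) + M"
      using L(2)[OF t] unfolding M_def by linarith+
    then have "exp (ln (W t / t) - M) \<le> exp (E\<^sub>0 (ln t) - E\<^sub>1 (ln t))"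
      "exp (E\<^sub>0 (ln t) - E\<^sub>1 (ln t)) \<le> exp (ln (W t / t) + M)"
      by simp_all
    moreover have "0 < W t / t" using W_pos[OF t] t by simp
    moreover have "?w\<^sub>0 t * ?w\<^sub>1 t = exp (E\<^sub>0 (ln t) - E\<^sub>1 (ln t))" by (simp flip: exp_add)
    ultimately show ?thesis by (simp add: exp_diff exp_add mult.commute)
  qed
  then show ?thesis
    using A\<^sub>0.strictly_monotone_weight_increasing A\<^sub>0.condition_L_increasing
      A\<^sub>1.strictly_monotone_weight_decreasing A\<^sub>1.condition_L_decreasing
    by (intro exI[of _ ?w\<^sub>0] exI[of _ ?w\<^sub>1] conjI exI[of _ "exp M"]) auto
qed

end

theorem theorem4p7:
  fixes w :: "real \<Rightarrow> real" and p :: real and M :: "real measure"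
  defines "M \<equiv> lebesgue_on {0..}"
  assumes "weight_function w"
    and "0 < p"
    and "\<exists>F. phi_function F \<and>
           equivalent_spaces M (lorentz_space M w p) (lorentz M w p)
             (orlicz_space M F) (luxemburg M F)"
  shows "\<exists>w\<^sub>0 w\<^sub>1. strictly_monotone_weight w\<^sub>0 \<and> condition_L w\<^sub>0 \<and>
           strictly_monotone_weight w\<^sub>1 \<and> condition_L w\<^sub>1 \<and>
           (\<exists>c>0. \<forall>t>0. 1 / c * (weight_integral w t / t) \<le> w\<^sub>0 t * w\<^sub>1 t \<and>
                        w\<^sub>0 t * w\<^sub>1 t \<le> c * (weight_integral w t / t))"
proof -
  obtain F c where F: "phi_function F" and c: "0 < c"
    and le: "\<And>f. f \<in> borel_measurable M \<Longrightarrow> ennreal (1 / c) * lorentz M w p f \<le> luxemburg M F f"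
      "\<And>f. f \<in> borel_measurable M \<Longrightarrow> luxemburg M F f \<le> ennreal c * lorentz M w p f"
    using assms(4) unfolding equivalent_spaces_def by blast
  interpret orlicz_lorentz w F p c
  proof
    fix f :: "real \<Rightarrow> complex" assume f: "f \<in> borel_measurable (lebesgue_on {0..})"
    show "luxemburg (lebesgue_on {0..}) F f \<le> ennreal c * lorentz (lebesgue_on {0..}) w p f"
      using le(2) f by (simp add: M_def)
    have "ennreal c * (ennreal (1 / c) * lorentz M w p f) \<le> ennreal c * luxemburg M F f"
      using le(1) f by (intro mult_left_mono) (auto simp: M_def)
    moreover have "ennreal c * ennreal (1 / c) = 1"
      using c by (simp flip: ennreal_mult')
    ultimately show "lorentz (lebesgue_on {0..}) w p f \<le> ennreal c * luxemburg (lebesgue_on {0..}) F f"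
      by (simp add: M_def flip: mult.assoc)
  qed (use assms F c in auto)
  show ?thesis by (rule factorization)
qed

end
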